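(* Let $\varphi=\frac{1+\sqrt5}{2}$ and $\mathcal{S}_\varphi=\{p+\lfloor \varphi^k\rfloor\mid p\in\mathcal{P},\ k\in\mathbb{N}\}$. Then $$0<\liminf_{x\to\infty}\frac{|\mathcal{S}_\varphi\cap[1,x]|}{x}\le\limsup_{x\to\infty}\frac{|\mathcal{S}_\varphi\cap[1,x]|}{x}\le\frac{1937}{1938}.$$ Moreover, $$\#\bigl\{n\in\mathbb{N},\ n\le x\mid n\notin\mathcal{P}+\{\lfloor\varphi^k\rfloor\mid k\ge1\}\bigr\}\ge\frac{x}{1938}-O(\log x).$$
   Context: $\mathbb{N}=\{1,2,3,\ldots\}$; $\mathcal{P}$ is the set of primes; $\lfloor x\rfloor$ is the greatest integer not exceeding $x$. For sets $X,Y$ of integers, $X+Y=\{x+y\mid x\in X, y\in Y\}$. *)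

theory Defs
  imports
    "HOL-Analysis.Analysis"
    "HOL-Computational_Algebra.Primes"
    "HOL-Library.Set_Algebras"
    "HOL-Library.Landau_Symbols"
begin

definition golden_ratio :: real  (\<open>\<phi>\<close>)
  where "\<phi> = (1 + sqrt 5) / 2"

(* prime on int only holds for positive integers, so p ranges over the usual primes. *)
definition S_phi :: "int set"
  where "S_phi = {p + \<lfloor>\<phi> ^ k\<rfloor> | (p::int) (k::nat). prime p \<and> k \<ge> 1}"

definition count_upto :: "int set \<Rightarrow> real \<Rightarrow> nat"
  where "count_upto A x = card {n \<in> A. 1 \<le> n \<and> of_int n \<le> x}"

end

theory Submission
  imports Defs
    "HOL-Computational_Algebra.Squarefree"
    "HOL-Library.Discrete_Functions"
    "HOL-Number_Theory.Number_Theory"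
    "HOL-Real_Asymp.Real_Asymp"
begin

text \<open>
  \<^bold>\<open>Upper density.\<close> The floor of the \<open>k\<close>-th power of the golden ratio is the Lucas number \<open>L\<^sub>k\<close>, minus \<open>1\<close>
  for even \<open>k\<close>, hence periodic in \<open>k\<close> modulo every integer. For \<open>n\<close> in the class of \<open>6821\<close> modulo
  \<open>9690 = 2 * 3 * 5 * 17 * 19\<close>, or in those of \<open>1361\<close> and \<open>3791\<close> modulo \<open>4830 = 2 * 3 * 5 * 7 * 23\<close>,
  a check over one period (\<open>72\<close> and \<open>48\<close>, respectively) shows that the difference of \<open>n\<close> and any of the floors is
  divisible by one of the prime factors of the modulus (\<open>covering\<close>). If the difference is prime, it is that prime
  factor, which happens only \<open>O(log x)\<close> times for \<open>n \<le> x\<close>. By inclusion and exclusion the three classes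
  together have density \<open>1/1938\<close>.
  
  \<^bold>\<open>Lower density.\<close> This is Romanoff's argument. There are at least a constant times \<open>N\<close> pairs of a prime \<open>p < N\<close> and
  an exponent \<open>k \<le> K\<close>, where \<open>K\<close> is of the order of \<open>ln N\<close>, by Chebyshev's lower bound \<open>primes_lower\<close>.
  By the Cauchy-Schwarz inequality, the sums that they form make up a positive proportion of the integers
  as soon as the number of pairs of them with equal sums is \<open>O(N)\<close>. If the exponents are equal, so are the pairs,
  and there are \<open>O(N)\<close> pairs by Chebyshev's upper bound \<open>primes_upper\<close>. A coincidence with two exponents \<open>l < k\<close>
  is a prime pair with difference \<open>h\<close>, the difference of the two floors. A Selberg sieve, in an
  explicit form that rests on orthogonal functions (\<open>sieve_bound\<close>), bounds the number of these prime pairs by a constant times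
  \<open>N / (ln N) ^ 2\<close> times the product of \<open>1 + 1 / p\<close> over the primes dividing \<open>h\<close> (\<open>prime_pairs_upper\<close>).
  
  It remains to see that this product is bounded on average over \<open>l < k \<le> K\<close> (\<open>singular_series_average\<close>).
  Expanded according to the largest prime factor \<open>p\<close>, it becomes a sum of terms of size at most \<open>p powr (-2/3)\<close>,
  and the indices at which the floors take the same value modulo \<open>p\<close> lie in at most four residue classes modulo
  the rank of apparition of \<open>p\<close> in the Fibonacci sequence (\<open>card_coincidences_le\<close>), because
  \<open>L\<^sub>k\<^sup>2 - L\<^sub>l\<^sup>2 = 5 * F\<^bsub>k+l\<^esub> * F\<^bsub>k-l\<^esub>\<close> for \<open>k\<close> and \<open>l\<close> of the same parity. Since at most \<open>r\<close> primes divide \<open>F\<^sub>r\<close>,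
  the resulting sum over \<open>p\<close> converges (\<open>sum_primes_fib_rank_bounded\<close>).
\<close>

section \<open>Lucas numbers and the floors of the powers of the golden ratio\<close>

text \<open>
  The Lucas numbers, extended by \<open>L\<^sub>0 = 2\<close>; they are integers so that differences are not truncated.
\<close>

fun lucas :: "nat \<Rightarrow> int" where
  "lucas 0 = 2"
| "lucas (Suc 0) = 1"
| "lucas (Suc (Suc n)) = lucas (Suc n) + lucas n"

text \<open>
  The algebraic conjugate of the golden ratio.
\<close>

definition golden_conj :: real where
  "golden_conj = (1 - sqrt 5) / 2"

lemma golden_conj_square: "golden_conj ^ 2 = golden_conj + 1"
  by (simp add: golden_conj_def power2_eq_square field_simps)

lemma golden_ratio_square: "\<phi> ^ 2 = \<phi> + 1"
  by (simp add: golden_ratio_def power2_eq_square field_simps)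

lemma golden_mult_conj: "\<phi> * golden_conj = -1"
  by (simp add: golden_ratio_def golden_conj_def field_simps)

lemma golden_bounds: "3 / 2 < \<phi>" "\<phi> < 2"
proof -
  have "2 < sqrt 5" by (rule real_less_rsqrt) simp
  then show "3 / 2 < \<phi>" by (simp add: golden_ratio_def)
  have "sqrt 5 < 3" by (rule real_less_lsqrt) simp_all
  then show "\<phi> < 2" by (simp add: golden_ratio_def)
qed

lemma golden_conj_bounds: "-1 < golden_conj" "golden_conj < 0"
proof -
  have "1 < sqrt 5" by (rule real_less_rsqrt) simp
  then show "golden_conj < 0" by (simp add: golden_conj_def)
  have "sqrt 5 < 3" by (rule real_less_lsqrt) simp_all
  then show "-1 < golden_conj" by (simp add: golden_conj_def)
qed

lemma lucas_eq_golden: "real_of_int (lucas k) = \<phi> ^ k + golden_conj ^ k"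
proof (induction k rule: lucas.induct)
  case 2
  then show ?case by (simp add: golden_ratio_def golden_conj_def field_simps)
next
  case (3 n)
  have "\<phi> ^ Suc (Suc n) = \<phi> ^ n * \<phi> ^ 2" "golden_conj ^ Suc (Suc n) = golden_conj ^ n * golden_conj ^ 2"
    by (simp_all add: power2_eq_square)
  then show ?case
    using 3 unfolding golden_ratio_square golden_conj_square by (simp add: algebra_simps)
qed simp

lemma fib_eq_golden: "sqrt 5 * real (fib k) = \<phi> ^ k - golden_conj ^ k"
proof -
  have "real (fib k) = (\<phi> ^ k - golden_conj ^ k) / sqrt 5"
    using fib_closed_form[of k] by (simp add: golden_ratio_def golden_conj_def Let_def)
  then show ?thesis by simp
qed

text \<open>
  The \<open>k\<close>-th power of the golden ratio differs from the Lucas number by the \<open>k\<close>-th power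
  of the conjugate, which lies in \<open>(0, 1)\<close> for even and in \<open>(-1, 0)\<close> for odd \<open>k\<close>.
\<close>

lemma floor_golden_power:
  assumes "k \<ge> 1"
  shows "\<lfloor>\<phi> ^ k\<rfloor> = lucas k - (if even k then 1 else 0)"
proof -
  have abs: "\<bar>golden_conj ^ k\<bar> < 1"
    using golden_conj_bounds assms by (simp add: power_abs power_less_one_iff)
  have eq: "\<phi> ^ k = real_of_int (lucas k) - golden_conj ^ k"
    by (simp add: lucas_eq_golden)
  show ?thesis
  proof (cases "even k")
    case True
    have "golden_conj ^ k > 0"
      using True golden_conj_bounds by (simp add: zero_less_power_eq)
    then show ?thesis using True eq abs by (intro floor_unique) auto
  next
    case False
    have "golden_conj ^ k < 0"
      using False golden_conj_bounds by (simp add: power_less_zero_eq)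
    then show ?thesis using False eq abs by (intro floor_unique; simp; linarith)
  qed
qed

section \<open>Covering congruences\<close>

lemma lucas_periodic:
  assumes "M dvd lucas T - 2" "M dvd lucas (Suc T) - 1"
  shows "M dvd lucas (k + T) - lucas k"
proof (induction k rule: lucas.induct)
  case (3 n)
  have "lucas (Suc (Suc n) + T) - lucas (Suc (Suc n))
      = (lucas (Suc n + T) - lucas (Suc n)) + (lucas (n + T) - lucas n)"
    by simp
  then show ?case using 3 by (metis dvd_add)
qed (use assms in simp_all)

lemma lucas_periodic_mult:
  assumes "M dvd lucas T - 2" "M dvd lucas (Suc T) - 1"
  shows "M dvd lucas (k + T * m) - lucas k"
proof (induction m)
  case (Suc m)
  have "lucas (k + T * Suc m) - lucas k
      = (lucas ((k + T * m) + T) - lucas (k + T * m)) + (lucas (k + T * m) - lucas k)"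
    by (simp add: algebra_simps)
  then show ?case using Suc lucas_periodic[OF assms] by (metis dvd_add)
qed simp

text \<open>
  Started in \<open>lucas k\<close>, \<open>lucas (Suc k)\<close> and the parity of \<open>k\<close>, the following test walks
  along \<open>n\<close> consecutive Lucas numbers, checks that at each of them some modulus from \<open>Q\<close>
  divides \<open>r\<close> minus the floor of the corresponding power of the golden ratio, and finally
  checks that the sequence has returned to its initial values modulo \<open>M\<close>.
\<close>

fun covering_test :: "int list \<Rightarrow> int \<Rightarrow> int \<Rightarrow> nat \<Rightarrow> int \<Rightarrow> int \<Rightarrow> bool \<Rightarrow> bool" where
  "covering_test Q M r 0 x y e \<longleftrightarrow> M dvd x - 2 \<and> M dvd y - 1"
| "covering_test Q M r (Suc n) x y e \<longleftrightarrow>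
     (\<exists>q\<in>set Q. q dvd r - (x - (if e then 1 else 0))) \<and> covering_test Q M r n y (y + x) (\<not> e)"

lemma covering_test_iff:
  "covering_test Q M r n (lucas k) (lucas (Suc k)) (even k) \<longleftrightarrow>
     (\<forall>j<n. \<exists>q\<in>set Q. q dvd r - (lucas (k + j) - (if even (k + j) then 1 else 0))) \<and>
     M dvd lucas (k + n) - 2 \<and> M dvd lucas (Suc (k + n)) - 1"
proof (induction n arbitrary: k)
  case (Suc n)
  show ?case
    using Suc[of "Suc k"] by (simp add: All_less_Suc2 add.commute conj_assoc)
qed simp

text \<open>
  A successful test over one even period \<open>T\<close> of the Lucas numbers modulo \<open>M\<close> shows that for
  \<open>n\<close> in the class of \<open>r\<close> modulo \<open>M\<close>, every difference between \<open>n\<close> and a floor is divisible by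
  some modulus in \<open>Q\<close>. The period has to be even because the floors depend on the parity of the exponent.
\<close>

lemma covering:
  assumes test: "covering_test Q M r T 2 1 True"
    and Q: "\<And>q. q \<in> set Q \<Longrightarrow> q dvd M" and T: "even T" "T > 0"
    and n: "M dvd n - r" and k: "k \<ge> 1"
  shows "\<exists>q\<in>set Q. q dvd n - \<lfloor>\<phi> ^ k\<rfloor>"
proof -
  define j where "j = k mod T"
  have k_eq: "k = j + T * (k div T)" by (simp add: j_def)
  have par: "even k \<longleftrightarrow> even j" using T by (subst k_eq) simp
  note t = covering_test_iff[of Q M r T 0, simplified, THEN iffD1, OF test]
  have "j < T" using T by (simp add: j_def)
  then obtain q where q: "q \<in> set Q" "q dvd r - (lucas j - (if even j then 1 else 0))"
    using t by blast
  have "M dvd lucas k - lucas j"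
    by (subst k_eq, rule lucas_periodic_mult) (use t in auto)
  then have "q dvd lucas k - lucas j" "q dvd n - r"
    using Q[OF q(1)] n by (auto intro: dvd_trans)
  then have "q dvd (n - r) + (r - (lucas j - (if even j then 1 else 0))) - (lucas k - lucas j)"
    using q(2) by (meson dvd_add dvd_diff)
  also have "\<dots> = n - \<lfloor>\<phi> ^ k\<rfloor>"
    using par by (simp add: floor_golden_power[OF k])
  finally show ?thesis using q(1) by blast
qed

lemma covering_9690:
  assumes "n mod 9690 = (6821 :: int)" "k \<ge> 1"
  shows "\<exists>q\<in>{2, 3, 5, 17, 19}. q dvd n - \<lfloor>\<phi> ^ k\<rfloor>"
proof -
  have t: "covering_test [2, 3, 5, 17, 19] 9690 6821 72 2 1 True" by code_simp
  have "(9690 :: int) dvd n - 6821" using assms(1) by (simp flip: mod_eq_dvd_iff)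
  moreover have "q dvd 9690" if "q \<in> set [2, 3, 5, 17, 19]" for q :: int using that by auto
  ultimately show ?thesis using covering[OF t _ _ _ _ assms(2), of n] by simp
qed

lemma covering_4830:
  assumes "n mod 4830 = (1361 :: int) \<or> n mod 4830 = (3791 :: int)" "k \<ge> 1"
  shows "\<exists>q\<in>{2, 3, 5, 7, 23}. q dvd n - \<lfloor>\<phi> ^ k\<rfloor>"
proof -
  have t: "covering_test [2, 3, 5, 7, 23] 4830 1361 48 2 1 True"
    "covering_test [2, 3, 5, 7, 23] 4830 3791 48 2 1 True" by code_simp+
  have "(4830 :: int) dvd n - 1361 \<or> (4830 :: int) dvd n - 3791" using assms(1)
    by (simp flip: mod_eq_dvd_iff)
  moreover have "q dvd 4830" if "q \<in> set [2, 3, 5, 7, 23]" for q :: int using that by auto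
  ultimately show ?thesis
    using covering[OF t(1) _ _ _ _ assms(2), of n] covering[OF t(2) _ _ _ _ assms(2), of n] by auto
qed

section \<open>The density of the covered integers\<close>

lemma card_residue_class:
  fixes M r :: int and x :: real
  assumes "0 \<le> r" "r < M" "r \<noteq> 0" "x \<ge> 0"
  defines "C \<equiv> {n::int. 1 \<le> n \<and> of_int n \<le> x \<and> n mod M = r}"
  shows "finite C" "x / of_int M - 1 \<le> real (card C)" "real (card C) \<le> x / of_int M + 1"
proof -
  define t where "t = (\<lfloor>x\<rfloor> - r) div M"
  have M: "M > 0" using assms by simp
  have C_eq: "C = (\<lambda>j. M * j + r) ` {0..t}"
  proof (intro equalityI subsetI)
    fix n assume "n \<in> C"
    then have n: "1 \<le> n" "n \<le> \<lfloor>x\<rfloor>" "n mod M = r" by (auto simp: C_def le_floor_iff)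
    have eq: "n = M * (n div M) + r" using n(3) by (metis mult_div_mod_eq)
    have "n div M \<le> t"
    proof -
      have "n div M = (n - r) div M" using M by (subst eq) simp
      also have "\<dots> \<le> t" unfolding t_def using n(2) M by (intro zdiv_mono1) auto
      finally show ?thesis .
    qed
    moreover have "n div M \<ge> 0" using n(1) M by (simp add: pos_imp_zdiv_nonneg_iff)
    ultimately show "n \<in> (\<lambda>j. M * j + r) ` {0..t}" using eq by auto
  next
    fix n assume "n \<in> (\<lambda>j. M * j + r) ` {0..t}"
    then obtain j where j: "0 \<le> j" "j \<le> t" "n = M * j + r" by auto
    have "M * j \<le> \<lfloor>x\<rfloor> - r"
    proof -
      have "M * j \<le> M * t" using j(2) M by simp
      also have "\<dots> = (\<lfloor>x\<rfloor> - r) - (\<lfloor>x\<rfloor> - r) mod M" by (simp add: t_def minus_mod_eq_mult_div)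
      also have "\<dots> \<le> \<lfloor>x\<rfloor> - r" using M by simp
      finally show ?thesis .
    qed
    moreover have "M * j \<ge> 0" using M j by simp
    ultimately have "1 \<le> n" "n \<le> \<lfloor>x\<rfloor>" using j assms(1,3) by linarith+
    moreover have "n mod M = r" using j assms by simp
    ultimately show "n \<in> C" by (auto simp: C_def le_floor_iff)
  qed
  show "finite C" by (simp add: C_eq)
  have card: "card C = nat (t + 1)"
    unfolding C_eq using M by (subst card_image) (auto simp: inj_on_def)
  have "(\<lfloor>x\<rfloor> - r) mod M < M" "(\<lfloor>x\<rfloor> - r) mod M \<ge> 0" using M by simp_all
  moreover have eq: "\<lfloor>x\<rfloor> - r = M * t + (\<lfloor>x\<rfloor> - r) mod M" by (simp add: t_def)
  ultimately have t: "\<lfloor>x\<rfloor> - r \<le> M * t + (M - 1)" "M * t \<le> \<lfloor>x\<rfloor> - r" by linarith+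
  have "- M < \<lfloor>x\<rfloor> - r" using assms by (smt (verit) zero_le_floor)
  then have "- M < M * t + (M - 1)" using t(1) by linarith
  then have "M * (t + 2) > 0" by (simp add: algebra_simps)
  then have "t + 2 > 0" using M by (simp add: zero_less_mult_iff)
  then have t0: "t + 1 \<ge> 0" by simp
  have cardr: "real (card C) = of_int t + 1" using t0 by (simp add: card)
  have "of_int (\<lfloor>x\<rfloor> - r) \<le> (of_int (M * t + (M - 1)) :: real)" "of_int (M * t) \<le> (of_int (\<lfloor>x\<rfloor> - r) :: real)"
    using t by (simp_all only: of_int_le_iff)
  moreover have "real_of_int r \<ge> 0" "real_of_int r \<le> of_int M - 1" using assms by linarith+
  ultimately have "x - 1 - (of_int M - 1) \<le> of_int M * real_of_int t + (of_int M - 1)"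
     "of_int M * real_of_int t \<le> x"
    by (simp_all, linarith+)
  then show "x / of_int M - 1 \<le> real (card C)" "real (card C) \<le> x / of_int M + 1"
    using M unfolding cardr by (simp_all add: field_simps)
qed

lemma S_phi_eq_plus: "S_phi = {p. prime p} + {\<lfloor>\<phi> ^ k\<rfloor> | k::nat. k \<ge> 1}"
  by (auto simp: S_phi_def set_plus_def)

text \<open>
  The classes \<open>6821\<close> mod \<open>9690\<close> and \<open>1361\<close>, \<open>3791\<close> mod \<open>4830\<close> have
  total density \<open>1/9690 + 2/4830 - 2/1560090 = 1/1938\<close>, where \<open>1560090\<close> is the least
  common multiple of \<open>9690\<close> and \<open>4830\<close>.
\<close>

definition covered :: "int set" where
  "covered = {n. n mod 9690 = 6821 \<or> n mod 4830 = 1361 \<or> n mod 4830 = 3791}"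

lemma card_covered:
  assumes "x \<ge> 0"
  shows "finite {n \<in> covered. 1 \<le> n \<and> real_of_int n \<le> x}"
    and "x / 1938 - 5 \<le> real (card {n \<in> covered. 1 \<le> n \<and> of_int n \<le> x})"
proof -
  define C where "C M r = {n::int. 1 \<le> n \<and> of_int n \<le> x \<and> n mod M = r}" for M r
  have fin: "finite (C 9690 6821)" "finite (C 4830 1361)" "finite (C 4830 3791)"
    unfolding C_def by (rule card_residue_class; use assms in simp)+
  have cov_eq: "{n \<in> covered. 1 \<le> n \<and> real_of_int n \<le> x}
      = C 9690 6821 \<union> (C 4830 1361 \<union> C 4830 3791)"
    by (auto simp: covered_def C_def)
  show "finite {n \<in> covered. 1 \<le> n \<and> real_of_int n \<le> x}"
    unfolding cov_eq using fin by simp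
  have lcm: "lcm 9690 (4830 :: int) = 1560090" by code_simp
  \<comment> \<open>The class mod 9690 meets each of the classes mod 4830 in one class mod 1560090,
    namely that of 1363421 and of 588221.\<close>
  have inter: "C 9690 6821 \<inter> C 4830 r \<subseteq> C 1560090 s"
    if "s mod 9690 = 6821" "s mod 4830 = r" "0 \<le> s" "s < 1560090" for r s
  proof
    fix n assume "n \<in> C 9690 6821 \<inter> C 4830 r"
    then have n: "n mod 9690 = s mod 9690" "n mod 4830 = s mod 4830" "1 \<le> n" "real_of_int n \<le> x"
      using that by (auto simp: C_def)
    then have "1560090 dvd n - s"
      unfolding lcm[symmetric] mod_eq_dvd_iff by (blast intro: lcm_least)
    then have "n mod 1560090 = s mod 1560090" by (simp add: mod_eq_dvd_iff)
    then show "n \<in> C 1560090 s" using n that by (simp add: C_def)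
  qed
  have i1: "card (C 9690 6821 \<inter> C 4830 1361) \<le> card (C 1560090 1363421)"
    by (rule card_mono[OF _ inter]; (unfold C_def)?, (rule card_residue_class)?; use assms in simp)
  have i2: "card (C 9690 6821 \<inter> C 4830 3791) \<le> card (C 1560090 588221)"
    by (rule card_mono[OF _ inter]; (unfold C_def)?, (rule card_residue_class)?; use assms in simp)
  have lo: "x / 9690 - 1 \<le> real (card (C 9690 6821))"
    using card_residue_class(2)[of 6821 9690 x] assms by (simp add: C_def)
  have lo1: "x / 4830 - 1 \<le> real (card (C 4830 1361))"
    using card_residue_class(2)[of 1361 4830 x] assms by (simp add: C_def)
  have lo2: "x / 4830 - 1 \<le> real (card (C 4830 3791))"
    using card_residue_class(2)[of 3791 4830 x] assms by (simp add: C_def)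
  have up1: "real (card (C 1560090 1363421)) \<le> x / 1560090 + 1"
    using card_residue_class(3)[of 1363421 1560090 x] assms by (simp add: C_def)
  have up2: "real (card (C 1560090 588221)) \<le> x / 1560090 + 1"
    using card_residue_class(3)[of 588221 1560090 x] assms by (simp add: C_def)
  have "C 4830 1361 \<inter> C 4830 3791 = {}" by (auto simp: C_def)
  then have B: "card (C 4830 1361 \<union> C 4830 3791) = card (C 4830 1361) + card (C 4830 3791)"
    using fin by (intro card_Un_disjoint) auto
  have "card (C 9690 6821) + card (C 4830 1361 \<union> C 4830 3791)
      = card (C 9690 6821 \<union> (C 4830 1361 \<union> C 4830 3791)) + card (C 9690 6821 \<inter> (C 4830 1361 \<union> C 4830 3791))"
    using fin by (intro card_Un_Int) auto
  moreover have "card (C 9690 6821 \<inter> (C 4830 1361 \<union> C 4830 3791))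
      \<le> card (C 9690 6821 \<inter> C 4830 1361) + card (C 9690 6821 \<inter> C 4830 3791)"
    unfolding Int_Un_distrib by (rule card_Un_le)
  ultimately have "real (card (C 9690 6821)) + real (card (C 4830 1361)) + real (card (C 4830 3791))
      \<le> real (card (C 9690 6821 \<union> (C 4830 1361 \<union> C 4830 3791)))
        + (real (card (C 1560090 1363421)) + real (card (C 1560090 588221)))"
    using B i1 i2 by linarith
  then show "x / 1938 - 5 \<le> real (card {n \<in> covered. 1 \<le> n \<and> of_int n \<le> x})"
    unfolding cov_eq using lo lo1 lo2 up1 up2 by (simp add: field_simps)
qed

lemma floor_golden_le_imp:
  assumes "real_of_int \<lfloor>\<phi> ^ k\<rfloor> \<le> x"
  shows "real k \<le> ln (x + 1) / ln (3 / 2)"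
proof -
  have "(3 / 2) ^ k \<le> \<phi> ^ k" using golden_bounds by (intro power_mono) auto
  also have "\<dots> \<le> x + 1" using assms by linarith
  finally have le: "(3 / 2) ^ k \<le> x + 1" .
  have "real k * ln (3 / 2) = ln ((3 / 2) ^ k)" by (simp add: ln_realpow)
  also have "\<dots> \<le> ln (x + 1)" using le by (subst ln_le_cancel_iff) (auto intro: less_le_trans[rotated])
  finally show ?thesis by (simp add: field_simps)
qed

text \<open>
  An integer of a covered class is represented only when the prime is one of the moduli
  of the covering.
\<close>

lemma covered_representation:
  assumes "n \<in> covered" "n \<in> S_phi"
  shows "\<exists>q\<in>{2, 3, 5, 7, 17, 19, 23}. \<exists>k\<ge>1. n = q + \<lfloor>\<phi> ^ k\<rfloor>"
proof -
  obtain p k where pk: "prime p" "k \<ge> 1" "n = p + \<lfloor>\<phi> ^ k\<rfloor>"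
    using assms(2) by (auto simp: S_phi_def)
  have "\<exists>q\<in>{2, 3, 5, 7, 17, 19, 23}. q dvd n - \<lfloor>\<phi> ^ k\<rfloor>"
    using covering_9690[OF _ pk(2), of n] covering_4830[OF _ pk(2), of n] assms(1)
    unfolding covered_def by blast
  then obtain q where q: "q \<in> {2, 3, 5, 7, 17, 19, 23 :: int}" "q dvd p" using pk(3) by auto
  have "q > 1" using q(1) by auto
  moreover have "\<forall>m. 0 \<le> m \<and> m dvd p \<longrightarrow> m = 1 \<or> m = p"
    using pk(1) by (simp add: prime_int_iff)
  ultimately have "q = p" using q(2) by (metis less_imp_le less_trans order_less_irrefl zero_less_one)
  then show ?thesis using q(1) pk by blast
qed

text \<open>
  Each of the seven moduli gives at most one represented covered integer per exponent,
  and the exponents in question are bounded by a multiple of \<open>ln (x + 1)\<close>.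
\<close>

lemma card_not_in_S_phi:
  assumes "x \<ge> 1"
  shows "x / 1938 - (5 + 7 * (ln (x + 1) / ln (3 / 2)))
      \<le> real (card {n::int. 1 \<le> n \<and> of_int n \<le> x \<and> n \<notin> S_phi})"
proof -
  define A where "A = {n \<in> covered. 1 \<le> n \<and> real_of_int n \<le> x}"
  define m where "m = ln (x + 1) / ln (3 / 2)"
  define Q where "Q = {2, 3, 5, 7, 17, 19, 23 :: int}"
  define E where "E = (\<lambda>(q, k). q + \<lfloor>\<phi> ^ k\<rfloor>) ` (Q \<times> {1..nat \<lfloor>m\<rfloor>})"
  have m0: "m \<ge> 0" using assms by (simp add: m_def)
  have finE: "finite E" by (simp add: E_def Q_def)
  have "card E \<le> card (Q \<times> {1..nat \<lfloor>m\<rfloor>})"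
    unfolding E_def by (rule card_image_le) (simp add: Q_def)
  also have "\<dots> = 7 * nat \<lfloor>m\<rfloor>" by (simp add: card_cartesian_product Q_def)
  finally have "real (card E) \<le> 7 * real (nat \<lfloor>m\<rfloor>)" by linarith
  also have "real (nat \<lfloor>m\<rfloor>) \<le> m" using m0 by linarith
  finally have cE: "real (card E) \<le> 7 * m" by simp
  have fin: "finite {n::int. 1 \<le> n \<and> of_int n \<le> x \<and> n \<notin> S_phi}"
    by (rule finite_subset[of _ "{1..\<lfloor>x\<rfloor>}"]) (auto simp: le_floor_iff)
  have "A \<subseteq> {n::int. 1 \<le> n \<and> of_int n \<le> x \<and> n \<notin> S_phi} \<union> E"
  proof
    fix n assume n: "n \<in> A"
    show "n \<in> {n::int. 1 \<le> n \<and> of_int n \<le> x \<and> n \<notin> S_phi} \<union> E"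
    proof (cases "n \<in> S_phi")
      case True
      then obtain q k where qk: "q \<in> Q" "k \<ge> 1" "n = q + \<lfloor>\<phi> ^ k\<rfloor>"
        using covered_representation[of n] n unfolding A_def Q_def by blast
      have "q \<ge> 0" using qk(1) by (auto simp: Q_def)
      then have "real_of_int \<lfloor>\<phi> ^ k\<rfloor> \<le> x" using n qk(3) by (simp add: A_def)
      then have "real k \<le> m" unfolding m_def by (rule floor_golden_le_imp)
      then have "k \<le> nat \<lfloor>m\<rfloor>" by (simp add: le_nat_floor)
      then show ?thesis using qk by (auto simp: E_def)
    qed (use n in \<open>auto simp: A_def\<close>)
  qed
  then have "card A \<le> card ({n::int. 1 \<le> n \<and> of_int n \<le> x \<and> n \<notin> S_phi} \<union> E)"
    using fin finE by (intro card_mono) auto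
  also have "\<dots> \<le> card {n::int. 1 \<le> n \<and> of_int n \<le> x \<and> n \<notin> S_phi} + card E"
    by (rule card_Un_le)
  finally show ?thesis
    using card_covered(2)[of x] assms cE unfolding A_def m_def by linarith
qed

lemma Limsup_S_phi:
  "Limsup at_top (\<lambda>x::real. ereal (real (count_upto S_phi x) / x)) \<le> ereal (1937 / 1938)"
proof -
  define g where "g x = 1937 / 1938 + (5 + 7 * (ln (x + 1) / ln (3 / 2))) / x" for x :: real
  have "eventually (\<lambda>x. ereal (real (count_upto S_phi x) / x) \<le> ereal (g x)) at_top"
    using eventually_ge_at_top[of 1]
  proof eventually_elim
    case (elim x)
    have "{1..\<lfloor>x\<rfloor>} = {n \<in> S_phi. 1 \<le> n \<and> of_int n \<le> x}
        \<union> {n::int. 1 \<le> n \<and> of_int n \<le> x \<and> n \<notin> S_phi}"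
      by (auto simp: le_floor_iff)
    then have "card {1..\<lfloor>x\<rfloor>} = card {n \<in> S_phi. 1 \<le> n \<and> of_int n \<le> x}
        + card {n::int. 1 \<le> n \<and> of_int n \<le> x \<and> n \<notin> S_phi}"
      using finite_atLeastAtMost_int[of 1 "\<lfloor>x\<rfloor>"]
      by (metis (no_types, lifting) card_Un_disjoint disjoint_iff finite_Un mem_Collect_eq)
    then have "real (count_upto S_phi x) + real (card {n::int. 1 \<le> n \<and> of_int n \<le> x \<and> n \<notin> S_phi}) = of_int \<lfloor>x\<rfloor>"
      using elim unfolding count_upto_def by simp linarith
    then have "real (count_upto S_phi x) \<le> x - (x / 1938 - (5 + 7 * (ln (x + 1) / ln (3 / 2))))"
      using card_not_in_S_phi[OF elim] by linarith
    then have "real (count_upto S_phi x) / x \<le> g x"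
      using elim by (simp add: g_def field_simps)
    then show ?case by simp
  qed
  then have "Limsup at_top (\<lambda>x::real. ereal (real (count_upto S_phi x) / x)) \<le> Limsup at_top (\<lambda>x. ereal (g x))"
    by (rule Limsup_mono)
  also have "(g \<longlongrightarrow> 1937 / 1938) at_top" unfolding g_def by real_asymp
  then have "((\<lambda>x. ereal (g x)) \<longlongrightarrow> ereal (1937 / 1938)) at_top" by simp
  then have "Limsup at_top (\<lambda>x. ereal (g x)) = ereal (1937 / 1938)"
    by (rule lim_imp_Limsup[rotated]) simp
  finally show ?thesis .
qed

section \<open>Sums of periodic functions\<close>

lemma sum_lessThan_add:
  fixes f :: "nat \<Rightarrow> 'a :: comm_monoid_add"
  shows "(\<Sum>n<a + b. f n) = (\<Sum>n<a. f n) + (\<Sum>n<b. f (a + n))"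
  by (induction b) (simp_all add: add.assoc)

lemma sum_periodic_le:
  fixes f :: "nat \<Rightarrow> real"
  assumes "m > 0" and per: "\<And>n. f (n mod m) = f n" and bd: "\<And>n. \<bar>f n\<bar> \<le> 1"
    and nonneg: "(\<Sum>n<m. f n) \<ge> 0"
  shows "(\<Sum>n<N. f n) \<le> real N * ((\<Sum>n<m. f n) / real m) + real m"
proof -
  define s where "s = (\<Sum>n<m. f n)"
  have shift: "f (m * q + n) = f n" for q n
    by (metis per mod_mult_self4 mult.commute)
  have full: "(\<Sum>n<m * q. f n) = real q * s" for q
    proof (induction q)
    case (Suc q)
    have "(\<Sum>n<m * Suc q. f n) = (\<Sum>n<m * q + m. f n)" by (simp add: add.commute)
    also have "\<dots> = real q * s + s" by (simp only: sum_lessThan_add Suc shift s_def)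
    finally show ?case by (simp add: algebra_simps)
  qed simp
  have "(\<Sum>n<N. f n) = (\<Sum>n<m * (N div m) + N mod m. f n)" by simp
  also have "\<dots> = real (N div m) * s + (\<Sum>n<N mod m. f n)"
    by (simp only: sum_lessThan_add full shift)
  also have "(\<Sum>n<N mod m. f n) \<le> (\<Sum>n<N mod m. 1)"
    by (intro sum_mono) (use bd in \<open>auto simp: abs_le_iff\<close>)
  also have "\<dots> \<le> real m" using \<open>m > 0\<close> by (simp add: less_imp_le)
  also have "real (N div m) * s \<le> real N / real m * s"
    using nonneg by (intro mult_right_mono) (auto simp: s_def of_nat_div_le_of_nat)
  finally show ?thesis by (simp add: s_def)
qed

text \<open>
  By the Chinese remainder theorem, the mean value of a product of periodic functions with
  coprime periods is the product of the mean values.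
\<close>

lemma sum_mult_coprime_periods:
  fixes f g :: "nat \<Rightarrow> real"
  assumes cop: "coprime m p" and pos: "m > 0" "p > 0"
    and f: "\<And>n. f (n mod m) = f n" and g: "\<And>n. g (n mod p) = g n"
  shows "(\<Sum>n<m * p. f n * g n) = (\<Sum>n<m. f n) * (\<Sum>n<p. g n)"
proof -
  define h where "h n = (n mod m, n mod p)" for n
  have inj: "inj_on h {..<m * p}"
  proof (rule inj_onI)
    fix a b assume ab: "a \<in> {..<m * p}" "b \<in> {..<m * p}" "h a = h b"
    then have "[a = b] (mod (m * p))"
      using cop by (intro coprime_cong_mult_nat) (auto simp: h_def cong_def)
    then show "a = b" using ab by (simp add: cong_def)
  qed
  have "h ` {..<m * p} = {..<m} \<times> {..<p}"
    proof (intro card_subset_eq)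
    show "h ` {..<m * p} \<subseteq> {..<m} \<times> {..<p}" using pos by (auto simp: h_def)
    show "card (h ` {..<m * p}) = card ({..<m} \<times> {..<p})" by (simp add: card_image[OF inj])
  qed simp
  then have bij: "bij_betw h {..<m * p} ({..<m} \<times> {..<p})"
    using inj by (simp add: bij_betw_def)
  have "(\<Sum>n<m. f n) * (\<Sum>n<p. g n) = (\<Sum>(i, j)\<in>{..<m} \<times> {..<p}. f i * g j)"
    by (simp add: sum_product sum.cartesian_product)
  also have "\<dots> = (\<Sum>n<m * p. case h n of (i, j) \<Rightarrow> f i * g j)"
    by (rule sum.reindex_bij_betw[OF bij, symmetric])
  also have "\<dots> = (\<Sum>n<m * p. f n * g n)" by (simp add: h_def f g)
  finally show ?thesis by simp
qed

lemma prime_dvd_prod_primes_iff: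
  fixes T :: "nat set"
  assumes "finite T" "\<And>p. p \<in> T \<Longrightarrow> prime p" "prime q"
  shows "q dvd \<Prod>T \<longleftrightarrow> q \<in> T"
proof
  assume "q dvd \<Prod>T"
  then obtain p where "p \<in> T" "q dvd p"
    using assms by (auto simp: prime_dvd_prod_iff)
  then show "q \<in> T" using assms by (metis primes_dvd_imp_eq)
next
  assume "q \<in> T"
  then show "q dvd \<Prod>T" using assms(1) by (rule dvd_prodI[rotated])
qed

lemma prod_primes_dvd:
  fixes T :: "nat set"
  assumes "finite T" "\<And>p. p \<in> T \<Longrightarrow> prime p" "\<And>p. p \<in> T \<Longrightarrow> p dvd n"
  shows "\<Prod>T dvd n"
  using assms
proof (induction T rule: finite_induct)
  case (insert q T)
  have "coprime q (\<Prod>T)"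
    using insert.hyps insert.prems prime_dvd_prod_primes_iff[of T q]
    by (metis insertI1 insertI2 prime_imp_coprime_nat)
  then show ?case using insert by (simp add: divides_mult)
qed simp

lemma prod_primes_pos:
  assumes "\<And>p. p \<in> T \<Longrightarrow> prime (p::nat)"
  shows "\<Prod>T > 0"
  using assms by (intro prod_pos) (auto simp: prime_gt_0_nat)

lemma prod_periodic:
  fixes f :: "nat \<Rightarrow> nat \<Rightarrow> real"
  assumes "finite T" "\<And>p n. p \<in> T \<Longrightarrow> f p (n mod p) = f p n"
  shows "(\<Prod>p\<in>T. f p (n mod \<Prod>T)) = (\<Prod>p\<in>T. f p n)"
proof (rule prod.cong[OF refl])
  fix p assume p: "p \<in> T"
  then have "p dvd \<Prod>T" using assms(1) by (rule dvd_prodI[rotated])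
  then have "n mod \<Prod>T mod p = n mod p" by (rule mod_mod_cancel)
  then show "f p (n mod \<Prod>T) = f p n" using assms(2)[OF p] by metis
qed

lemma sum_prod_periodic:
  fixes f :: "nat \<Rightarrow> nat \<Rightarrow> real"
  assumes "finite T" "\<And>p. p \<in> T \<Longrightarrow> prime p" "\<And>p n. p \<in> T \<Longrightarrow> f p (n mod p) = f p n"
  shows "(\<Sum>n<\<Prod>T. \<Prod>p\<in>T. f p n) = (\<Prod>p\<in>T. \<Sum>n<p. f p n)"
  using assms
proof (induction T rule: finite_induct)
  case (insert q T)
  have "coprime (\<Prod>T) q"
    using insert.hyps insert.prems prime_dvd_prod_primes_iff[of T q]
    by (metis coprime_commute insertI1 insertI2 prime_imp_coprime_nat)
  then have "(\<Sum>n<\<Prod>T * q. (\<Prod>p\<in>T. f p n) * f q n)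
      = (\<Sum>n<\<Prod>T. \<Prod>p\<in>T. f p n) * (\<Sum>n<q. f q n)"
    using insert.hyps insert.prems
    by (intro sum_mult_coprime_periods prod_periodic prod_primes_pos) (auto simp: prime_gt_0_nat)
  then show ?case using insert by (simp add: mult.commute)
qed simp

section \<open>An upper bound sieve for prime pairs\<close>

text \<open>
  Squarefree numbers up to \<open>y\<close> without prime factors below \<open>7\<close>, represented by
  their sets of prime factors. Leaving out finitely many primes changes the sieve only by a
  constant factor. Without \<open>2\<close> and \<open>3\<close> the functions \<open>sieve_psi h p\<close> below are bounded by
  \<open>1\<close>, and the analysis of the floors modulo \<open>p\<close> needs \<open>p > 5\<close>.
\<close>

definition prime_sets :: "nat \<Rightarrow> nat set set" where
  "prime_sets y = {A. finite A \<and> (\<forall>p\<in>A. prime p \<and> 7 \<le> p) \<and> \<Prod>A \<le> y}"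

lemma prime_setsD:
  assumes "A \<in> prime_sets y"
  shows "finite A" "\<And>p. p \<in> A \<Longrightarrow> prime p" "\<And>p. p \<in> A \<Longrightarrow> 7 \<le> p" "\<Prod>A \<le> y" "\<Prod>A > 0"
    "A \<subseteq> {..y}"
proof -
  show A: "finite A" "\<And>p. p \<in> A \<Longrightarrow> prime p" "\<And>p. p \<in> A \<Longrightarrow> 7 \<le> p" "\<Prod>A \<le> y"
    using assms by (auto simp: prime_sets_def)
  show pos: "\<Prod>A > 0" using A(2) by (rule prod_primes_pos)
  show "A \<subseteq> {..y}"
  proof
    fix p assume "p \<in> A"
    then have "p dvd \<Prod>A" using A(1) by (rule dvd_prodI[rotated])
    then have "p \<le> \<Prod>A" using pos by (rule dvd_imp_le)
    then show "p \<in> {..y}" using A(4) by simp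
  qed
qed

lemma finite_prime_sets: "finite (prime_sets y)"
  by (rule finite_subset[of _ "Pow {..y}"]) (use prime_setsD(6) in auto)

lemma empty_in_prime_sets: "y \<ge> 1 \<Longrightarrow> {} \<in> prime_sets y"
  by (simp add: prime_sets_def)

lemma inj_on_prod_prime_sets: "inj_on Prod (prime_sets y)"
proof (rule inj_onI)
  have sub: "A \<subseteq> B" if "A \<in> prime_sets y" "B \<in> prime_sets y" "\<Prod>A = \<Prod>B" for A B
    using that prime_dvd_prod_primes_iff prime_setsD(1,2) by (metis subsetI)
  fix A B assume "A \<in> prime_sets y" "B \<in> prime_sets y" "\<Prod>A = \<Prod>B"
  then show "A = B" using sub[of A B] sub[of B A] by auto
qed

lemma sum_prime_sets_le:
  fixes f :: "nat \<Rightarrow> real"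
  assumes "\<And>n. n \<in> {1..y} \<Longrightarrow> f n \<ge> 0"
  shows "(\<Sum>A\<in>prime_sets y. f (\<Prod>A)) \<le> (\<Sum>n=1..y. f n)"
proof -
  have "(\<Sum>A\<in>prime_sets y. f (\<Prod>A)) = (\<Sum>n\<in>Prod ` prime_sets y. f n)"
    by (simp add: sum.reindex[OF inj_on_prod_prime_sets])
  also have "\<dots> \<le> (\<Sum>n=1..y. f n)"
    using prime_setsD(4,5) assms by (intro sum_mono2) (auto simp: Suc_le_eq)
  finally show ?thesis .
qed

text \<open>
  For the prime \<open>p\<close> the sieve removes the residue classes of \<open>0\<close> and \<open>-h\<close>; this is the
  number of these classes.
\<close>

definition sieve_omega :: "nat \<Rightarrow> nat \<Rightarrow> real" where
  "sieve_omega h p = (if p dvd h then 1 else 2)"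

text \<open>
  The multiplicative weight of Selberg's sieve at the prime \<open>p\<close>.
\<close>

definition sieve_g :: "nat \<Rightarrow> nat \<Rightarrow> real" where
  "sieve_g h p = sieve_omega h p / (real p - sieve_omega h p)"

text \<open>
  A \<open>p\<close>-periodic function of mean value zero that is constant, equal to \<open>sieve_g h p\<close>, on the
  integers that survive the sieve by \<open>p\<close>. Its mean square is \<open>sieve_g h p\<close> as well.
\<close>

definition sieve_psi :: "nat \<Rightarrow> nat \<Rightarrow> nat \<Rightarrow> real" where
  "sieve_psi h p n = (if p dvd n * (n + h) then -1 else sieve_g h p)"

text \<open>
  The main term of Selberg's sieve: the sum of the weights of the squarefree moduli up to \<open>z\<close>.
\<close>

definition sieve_sum :: "nat \<Rightarrow> nat \<Rightarrow> real" where
  "sieve_sum h z = (\<Sum>A\<in>prime_sets z. \<Prod>p\<in>A. sieve_g h p)"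

lemma sieve_g_bounds:
  assumes "7 \<le> p"
  shows "0 < sieve_g h p" "sieve_g h p \<le> 1" "sieve_omega h p / real p \<le> sieve_g h p"
  using assms unfolding sieve_g_def sieve_omega_def by (auto simp: divide_simps)

lemma sieve_psi_periodic: "sieve_psi h p (n mod p) = sieve_psi h p n"
proof -
  have "p dvd (n mod p) * (n mod p + h) \<longleftrightarrow> p dvd n * (n + h)"
    unfolding dvd_eq_mod_eq_0 by (metis mod_add_left_eq mod_mult_eq mod_mod_trivial)
  then show ?thesis by (simp add: sieve_psi_def)
qed

lemma sieve_psi_abs_le: "7 \<le> p \<Longrightarrow> \<bar>sieve_psi h p n\<bar> \<le> 1"
  using sieve_g_bounds[of p h] by (auto simp: sieve_psi_def)

lemma card_sieved_classes:
  assumes "prime p" "7 \<le> p"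
  shows "real (card {n. n < p \<and> p dvd n * (n + h)}) = sieve_omega h p"
proof (cases "p dvd h")
  case True
  have "{n. n < p \<and> p dvd n * (n + h)} = {0}"
  proof (intro equalityI subsetI)
    fix n assume "n \<in> {n. n < p \<and> p dvd n * (n + h)}"
    then have "n < p" "p dvd n"
      using assms True by (auto simp: prime_dvd_mult_iff dvd_add_left_iff)
    then show "n \<in> {0}" by (auto dest: dvd_imp_le)
  qed (use assms in auto)
  then show ?thesis using True by (simp add: sieve_omega_def)
next
  case False
  define m where "m = p - h mod p"
  have h: "h mod p > 0" "h mod p < p" using False assms by (auto simp: dvd_eq_mod_eq_0)
  have m: "0 < m" "m < p" using h by (auto simp: m_def)
  have iff: "p dvd n + h \<longleftrightarrow> n = m" if "n < p" for n
  proof -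
    have "p dvd n + h \<longleftrightarrow> p dvd n + h mod p"
      unfolding dvd_eq_mod_eq_0 by (simp add: mod_add_right_eq)
    also have "\<dots> \<longleftrightarrow> n + h mod p = p"
    proof
      assume "p dvd n + h mod p"
      then obtain c where c: "n + h mod p = p * c" by blast
      then have "p * c < p * 2" "p * c > 0" using that h by linarith+
      then have "c = 1" by (cases c) auto
      then show "n + h mod p = p" using c by simp
    qed simp
    also have "\<dots> \<longleftrightarrow> n = m" using h by (auto simp: m_def)
    finally show ?thesis .
  qed
  have "{n. n < p \<and> p dvd n * (n + h)} = {0, m}"
  proof (intro equalityI subsetI)
    fix n assume n: "n \<in> {n. n < p \<and> p dvd n * (n + h)}"
    then have "p dvd n \<or> n = m" using iff assms by (auto simp: prime_dvd_mult_iff)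
    then show "n \<in> {0, m}" using n by (auto dest: dvd_imp_le)
  qed (use m iff in auto)
  then show ?thesis using False m by (simp add: sieve_omega_def)
qed

lemma sum_sieve_psi:
  assumes "prime p" "7 \<le> p"
  shows "(\<Sum>n<p. sieve_psi h p n) = 0"
    and "(\<Sum>n<p. sieve_psi h p n ^ 2) = real p * sieve_g h p"
proof -
  define R where "R = {n. n < p \<and> p dvd n * (n + h)}"
  have R: "R \<subseteq> {..<p}" "finite R" by (auto simp: R_def)
  have cR: "real (card R) = sieve_omega h p"
    unfolding R_def by (rule card_sieved_classes[OF assms])
  have cR': "real (card ({..<p} - R)) = real p - sieve_omega h p"
    using R cR by (simp add: card_Diff_subset of_nat_diff card_mono[of "{..<p}" R, simplified])
  have om: "sieve_omega h p > 0" "real p - sieve_omega h p > 0"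
    using assms by (auto simp: sieve_omega_def)
  have split: "(\<Sum>n<p. F (sieve_psi h p n)) = sieve_omega h p * F (-1) + (real p - sieve_omega h p) * F (sieve_g h p)"
    for F :: "real \<Rightarrow> real"
  proof -
    have "(\<Sum>n<p. F (sieve_psi h p n)) = (\<Sum>n\<in>{..<p} - R. F (sieve_psi h p n)) + (\<Sum>n\<in>R. F (sieve_psi h p n))"
      using R by (intro sum.subset_diff) auto
    also have "(\<Sum>n\<in>{..<p} - R. F (sieve_psi h p n)) = (\<Sum>n\<in>{..<p} - R. F (sieve_g h p))"
      by (intro sum.cong) (auto simp: R_def sieve_psi_def)
    also have "(\<Sum>n\<in>R. F (sieve_psi h p n)) = (\<Sum>n\<in>R. F (-1))"
      by (intro sum.cong) (auto simp: R_def sieve_psi_def)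
    finally show ?thesis by (simp add: cR cR')
  qed
  show "(\<Sum>n<p. sieve_psi h p n) = 0"
    using split[of "\<lambda>x. x"] om by (simp add: sieve_g_def)
  show "(\<Sum>n<p. sieve_psi h p n ^ 2) = real p * sieve_g h p"
  proof -
    define w d where "w = sieve_omega h p" and "d = real p - sieve_omega h p"
    have "(\<Sum>n<p. sieve_psi h p n ^ 2) = w + d * (w / d) ^ 2"
      using split[of "\<lambda>x. x ^ 2"] by (simp add: sieve_g_def w_def d_def)
    also have "\<dots> = (w + d) * (w / d)"
      using om by (simp add: d_def[symmetric] power2_eq_square field_simps)
    finally show ?thesis by (simp add: sieve_g_def w_def d_def)
  qed
qed

text \<open>The functions \<open>n \<mapsto> \<Prod>p\<in>A. sieve_psi h p n\<close> are almost orthogonal on an interval.\<close>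

lemma sieve_psi_correlation:
  assumes A: "A \<in> prime_sets z" and B: "B \<in> prime_sets z"
  shows "(\<Sum>n<N. (\<Prod>p\<in>A. sieve_psi h p n) * (\<Prod>p\<in>B. sieve_psi h p n))
    \<le> (if A = B then real N * (\<Prod>p\<in>A. sieve_g h p) else 0) + real (\<Prod>A) * real (\<Prod>B)"
proof -
  define f where "f p n = (if p \<in> A \<inter> B then sieve_psi h p n ^ 2 else sieve_psi h p n)" for p n
  define T where "T = A \<union> B"
  note a = prime_setsD[OF A] and b = prime_setsD[OF B]
  have T: "finite T" "\<And>p. p \<in> T \<Longrightarrow> prime p" "\<And>p. p \<in> T \<Longrightarrow> 7 \<le> p"
    using a b by (auto simp: T_def)
  have per: "f p (n mod p) = f p n" for p n by (simp add: f_def sieve_psi_periodic)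
  have bd: "\<bar>f p n\<bar> \<le> 1" if "p \<in> T" for p n
    using sieve_psi_abs_le[OF T(3)[OF that]] by (simp add: f_def abs_square_le_1)
  have prodT: "(\<Prod>p\<in>A. sieve_psi h p n) * (\<Prod>p\<in>B. sieve_psi h p n) = (\<Prod>p\<in>T. f p n)" for n
  proof -
    have "(\<Prod>p\<in>A. sieve_psi h p n) = (\<Prod>p\<in>T. if p \<in> A then sieve_psi h p n else 1)"
      using T(1) by (intro prod.mono_neutral_cong_left) (auto simp: T_def)
    moreover have "(\<Prod>p\<in>B. sieve_psi h p n) = (\<Prod>p\<in>T. if p \<in> B then sieve_psi h p n else 1)"
      using T(1) by (intro prod.mono_neutral_cong_left) (auto simp: T_def)
    ultimately have "(\<Prod>p\<in>A. sieve_psi h p n) * (\<Prod>p\<in>B. sieve_psi h p n)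
        = (\<Prod>p\<in>T. (if p \<in> A then sieve_psi h p n else 1) * (if p \<in> B then sieve_psi h p n else 1))"
      by (simp add: prod.distrib)
    also have "\<dots> = (\<Prod>p\<in>T. f p n)"
      by (intro prod.cong) (auto simp: T_def f_def power2_eq_square)
    finally show ?thesis .
  qed
  have mean: "(\<Sum>n<\<Prod>T. \<Prod>p\<in>T. f p n) = (if A = B then real (\<Prod>A) * (\<Prod>p\<in>A. sieve_g h p) else 0)"
  proof (cases "A = B")
    case True
    have "(\<Sum>n<\<Prod>T. \<Prod>p\<in>T. f p n) = (\<Prod>p\<in>T. \<Sum>n<p. f p n)"
      using T per by (intro sum_prod_periodic) auto
    also have "\<dots> = (\<Prod>p\<in>A. real p * sieve_g h p)"
      using True a by (intro prod.cong) (auto simp: T_def f_def sum_sieve_psi)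
    finally show ?thesis using True by (simp add: prod.distrib)
  next
    case False
    then obtain q where q: "q \<in> T" "q \<notin> A \<inter> B" by (auto simp: T_def)
    have "(\<Sum>n<\<Prod>T. \<Prod>p\<in>T. f p n) = (\<Prod>p\<in>T. \<Sum>n<p. f p n)"
      using T per by (intro sum_prod_periodic) auto
    also have "f q n = sieve_psi h q n" for n using q(2) by (simp only: f_def if_False)
    then have "(\<Sum>n<q. f q n) = 0"
      using sum_sieve_psi(1)[OF T(2)[OF q(1)] T(3)[OF q(1)]] by simp
    then have "(\<Prod>p\<in>T. \<Sum>n<p. f p n) = 0"
      using T(1) q(1) by (intro prod_zero) auto
    finally show ?thesis using False by simp
  qed
  have g: "(\<Prod>p\<in>A. sieve_g h p) \<ge> 0"
    using sieve_g_bounds(1) a(3) by (intro prod_nonneg) (simp add: less_imp_le)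
  have "(\<Sum>n<N. \<Prod>p\<in>T. f p n) \<le> real N * ((\<Sum>n<\<Prod>T. \<Prod>p\<in>T. f p n) / real (\<Prod>T)) + real (\<Prod>T)"
  proof (rule sum_periodic_le)
    show "\<Prod>T > 0" using T(2) by (rule prod_primes_pos)
    show "(\<Prod>p\<in>T. f p (n mod \<Prod>T)) = (\<Prod>p\<in>T. f p n)" for n
      using T(1) per by (rule prod_periodic)
    show "\<bar>\<Prod>p\<in>T. f p n\<bar> \<le> 1" for n
      unfolding abs_prod using bd by (intro prod_le_1) auto
    show "0 \<le> (\<Sum>n<\<Prod>T. \<Prod>p\<in>T. f p n)" unfolding mean using g by (auto intro!: mult_nonneg_nonneg prod_nonneg)
  qed
  also have "real N * ((\<Sum>n<\<Prod>T. \<Prod>p\<in>T. f p n) / real (\<Prod>T))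
      = (if A = B then real N * (\<Prod>p\<in>A. sieve_g h p) else 0)"
  proof -
    have "real (\<Prod>A) > 0" using a(5) by (simp only: of_nat_0_less_iff)
    then show ?thesis unfolding mean by (cases "A = B") (simp_all add: T_def del: of_nat_prod)
  qed
  also have "\<Prod>T \<le> \<Prod>A * \<Prod>B"
  proof -
    have "\<Prod>T = \<Prod>A * \<Prod>(B - A)"
      unfolding T_def by (subst prod.union_disjoint[symmetric]) (use a b in \<open>auto intro!: prod.cong\<close>)
    also have "\<Prod>(B - A) \<le> \<Prod>B"
      using b by (intro dvd_imp_le prod_dvd_prod_subset) auto
    finally show ?thesis by simp
  qed
  then have "real (\<Prod>T) \<le> real (\<Prod>A) * real (\<Prod>B)"
    unfolding of_nat_mult[symmetric] of_nat_le_iff .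
  finally show ?thesis by (simp add: prodT)
qed

text \<open>
  The sum \<open>F\<close> of the products of \<open>sieve_psi\<close> over all sets in \<open>prime_sets z\<close> equals
  \<open>sieve_sum h z\<close> on the integers that survive, while the sum of its square over all \<open>n < N\<close> is
  about \<open>N\<close> times the same number, by orthogonality. This is the upper bound of Selberg's sieve with the
  optimal weights made explicit.
\<close>

lemma sieve_bound:
  assumes "z \<ge> 1"
  shows "sieve_sum h z ^ 2 *
      real (card {n. n < N \<and> (\<forall>p. prime p \<and> 7 \<le> p \<and> p \<le> z \<longrightarrow> \<not> p dvd n * (n + h))})
    \<le> real N * sieve_sum h z + real z ^ 4"
proof -
  define V where "V = {n. n < N \<and> (\<forall>p. prime p \<and> 7 \<le> p \<and> p \<le> z \<longrightarrow> \<not> p dvd n * (n + h))}"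
  define P where "P A n = (\<Prod>p\<in>A. sieve_psi h p n)" for A n
  define F where "F n = (\<Sum>A\<in>prime_sets z. P A n)" for n
  have F_V: "F n = sieve_sum h z" if "n \<in> V" for n
    unfolding F_def sieve_sum_def
  proof (rule sum.cong[OF refl])
    fix A assume A: "A \<in> prime_sets z"
    show "P A n = (\<Prod>p\<in>A. sieve_g h p)"
      unfolding P_def using prime_setsD[OF A] that
      by (intro prod.cong) (auto simp: V_def sieve_psi_def)
  qed
  have "sieve_sum h z ^ 2 * real (card V) = (\<Sum>n\<in>V. F n ^ 2)" by (simp add: F_V)
  also have "\<dots> \<le> (\<Sum>n<N. F n ^ 2)" by (intro sum_mono2) (auto simp: V_def)
  also have "\<dots> = (\<Sum>n<N. \<Sum>A\<in>prime_sets z. \<Sum>B\<in>prime_sets z. P A n * P B n)"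
    by (simp add: F_def power2_eq_square sum_product)
  also have "\<dots> = (\<Sum>A\<in>prime_sets z. \<Sum>B\<in>prime_sets z. \<Sum>n<N. P A n * P B n)"
    by (subst sum.swap) (simp add: sum.swap[of _ _ "{..<N}"])
  also have "\<dots> \<le> (\<Sum>A\<in>prime_sets z. \<Sum>B\<in>prime_sets z.
      (if A = B then real N * (\<Prod>p\<in>A. sieve_g h p) else 0) + real (\<Prod>A) * real (\<Prod>B))"
    unfolding P_def by (intro sum_mono sieve_psi_correlation)
  also have "\<dots> = real N * sieve_sum h z + (\<Sum>A\<in>prime_sets z. real (\<Prod>A)) ^ 2"
    unfolding sum.distrib power2_eq_square sum_product
    by (simp add: sum.delta finite_prime_sets sieve_sum_def sum_distrib_left del: of_nat_prod)
  also have "(\<Sum>A\<in>prime_sets z. real (\<Prod>A)) \<le> (\<Sum>n=1..z. real n)"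
    by (rule sum_prime_sets_le) simp
  then have "(\<Sum>A\<in>prime_sets z. real (\<Prod>A)) ^ 2 \<le> (\<Sum>n=1..z. real n) ^ 2"
    by (intro power_mono sum_nonneg) (auto intro: prod_nonneg)
  also have "(\<Sum>n=1..z. real n) \<le> (\<Sum>n=1..z. real z)" by (intro sum_mono) auto
  then have "(\<Sum>n=1..z. real n) ^ 2 \<le> (real z * real z) ^ 2" by (intro power_mono sum_nonneg) auto
  also have "\<dots> = real z ^ 4" by (simp add: power_mult_distrib flip: power_add power2_eq_square power_mult)
  finally show ?thesis by (simp add: V_def)
qed

lemma sieve_sum_ge_1: "z \<ge> 1 \<Longrightarrow> sieve_sum h z \<ge> 1"
proof -
  assume z: "z \<ge> 1"
  have "(\<Prod>p\<in>{}. sieve_g h p) \<le> sieve_sum h z"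
    unfolding sieve_sum_def
    by (rule member_le_sum)
      (use empty_in_prime_sets[OF z] finite_prime_sets in
        \<open>auto intro!: prod_nonneg less_imp_le[OF sieve_g_bounds(1)] dest: prime_setsD(3)\<close>)
  then show ?thesis by simp
qed

section \<open>Lower bounds for the main term of the sieve\<close>

text \<open>
  The sum of the reciprocals of the squarefree numbers up to \<open>y\<close> without prime factors below \<open>7\<close>.
\<close>

definition recip_sum :: "nat \<Rightarrow> real" where
  "recip_sum y = (\<Sum>A\<in>prime_sets y. 1 / real (\<Prod>A))"

lemma sum_inverse_squares_le: "(\<Sum>n=1..N. 1 / real n ^ 2) \<le> 2"
proof (cases "N = 0")
  case False
  then have "N \<ge> 1" by simp
  then have "(\<Sum>n=1..N. 1 / real n ^ 2) \<le> 2 - 1 / real N"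
  proof (induction N rule: nat_induct_at_least)
    case (Suc n)
    have "1 / real (Suc n) ^ 2 \<le> 1 / (real n * real (Suc n))"
      using Suc.hyps by (intro divide_left_mono) (auto simp: power2_eq_square intro!: mult_mono)
    also have "\<dots> = 1 / real n - 1 / real (Suc n)"
      using Suc.hyps by (simp add: field_simps)
    finally have "1 / real (Suc n) ^ 2 \<le> 1 / real n - 1 / real (Suc n)" .
    then show ?case using Suc by simp
  qed simp
  then show ?thesis by (smt (verit) divide_nonneg_nonneg of_nat_0_le_iff)
qed simp

lemma prod_prime_factors_squarefree:
  fixes s :: nat
  assumes "squarefree s"
  shows "\<Prod>(prime_factors s) = s"
proof -
  have s: "s \<noteq> 0" using assms by (metis not_squarefree_0)
  have "s = (\<Prod>p\<in>prime_factors s. p ^ multiplicity p s)"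
    using s by (simp add: prod_prime_factors)
  also have "\<dots> = (\<Prod>p\<in>prime_factors s. p)"
    using assms squarefree_factorial_semiring'[OF s] by (intro prod.cong) auto
  finally show ?thesis by simp
qed

text \<open>
  Writing a number \<open>30 * m + 1\<close> as a squarefree number times a square shows that the sum of the reciprocals
  of these numbers up to \<open>y\<close> is at most twice \<open>recip_sum y\<close>.
\<close>

lemma recip_sum_ge:
  assumes y: "y \<ge> 900"
  shows "recip_sum y \<ge> ln (real y) / 120"
proof -
  define M where "M = (y + 29) div 30"
  define i :: "nat set \<times> nat \<Rightarrow> nat" where "i = (\<lambda>(A, k). (\<Prod>A * k ^ 2 - 1) div 30)"
  have "(\<Sum>m<M. 1 / real (30 * m + 1))
      \<le> (\<Sum>(A, k)\<in>prime_sets y \<times> {1..y}. (1 / real (\<Prod>A)) * (1 / real k ^ 2))"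
  proof (rule sum_le_included[where i = i])
    show "\<forall>m\<in>{..<M}. \<exists>a\<in>prime_sets y \<times> {1..y}. i a = m \<and>
        1 / real (30 * m + 1) \<le> (case a of (A, k) \<Rightarrow> (1 / real (\<Prod>A)) * (1 / real k ^ 2))"
    proof
      fix m assume "m \<in> {..<M}"
      define n where "n = 30 * m + 1"
      have n: "n \<le> y" "n > 0" using \<open>m \<in> {..<M}\<close> unfolding n_def M_def by auto
      define k where "k = square_part n"
      define A where "A = prime_factors (squarefree_part n)"
      have sq: "squarefree (squarefree_part n)" by blast
      have A: "\<Prod>A = squarefree_part n"
        unfolding A_def by (rule prod_prime_factors_squarefree[OF sq])
      have eq: "n = \<Prod>A * k ^ 2" using squarefree_decompose[of n] by (simp add: A k_def)
      have "k \<noteq> 0" using n by (simp add: k_def)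
      moreover have "k dvd n" using eq by (metis dvd_mult dvd_power zero_less_numeral)
      ultimately have k: "k \<in> {1..y}" using n dvd_imp_le[of k n] by auto
      have "p \<ge> 7" if "p \<in> A" for p
      proof (rule ccontr)
        assume "\<not> p \<ge> 7"
        have p: "prime p" "p dvd \<Prod>A" using that by (auto simp: A A_def in_prime_factors_iff)
        have "p dvd 30 * m + 1" using p(2) eq unfolding n_def by (metis dvd_mult2)
        moreover have "p \<in> {2, 3, 5}"
        proof -
          have "p \<in> {0, 1, 2, 3, 4, 5, 6}" using \<open>\<not> p \<ge> 7\<close> by auto
          moreover have "\<not> prime (4 :: nat)" "\<not> prime (6 :: nat)"
            by (auto simp: prime_nat_iff intro!: exI[of _ 2])
          ultimately show ?thesis using p(1) by auto
        qed
        then have "p dvd 30 * m" by auto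
        ultimately have "p dvd 1" by (metis dvd_add_right_iff)
        then show False using p(1) by auto
      qed
      moreover have "\<Prod>A \<le> n" using eq n by (intro dvd_imp_le) auto
      ultimately have "A \<in> prime_sets y" using n by (auto simp: prime_sets_def A_def in_prime_factors_iff)
      moreover have "i (A, k) = m" using eq by (simp add: i_def n_def flip: eq)
      moreover have "1 / real (30 * m + 1) = (1 / real (\<Prod>A)) * (1 / real k ^ 2)"
        using eq unfolding n_def by (metis of_nat_mult of_nat_power times_divide_times_eq mult_1)
      ultimately show "\<exists>a\<in>prime_sets y \<times> {1..y}. i a = m \<and>
        1 / real (30 * m + 1) \<le> (case a of (A, k) \<Rightarrow> (1 / real (\<Prod>A)) * (1 / real k ^ 2))"
        using k by (intro bexI[of _ "(A, k)"]) auto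
    qed
  qed (auto simp: finite_prime_sets prod_nonneg)
  also have "\<dots> = recip_sum y * (\<Sum>k=1..y. 1 / real k ^ 2)"
    unfolding recip_sum_def sum_product sum.cartesian_product ..
  also have "\<dots> \<le> recip_sum y * 2"
    unfolding recip_sum_def by (intro mult_left_mono sum_inverse_squares_le sum_nonneg) (simp add: prod_nonneg)
  finally have le: "(\<Sum>m<M. 1 / real (30 * m + 1)) \<le> 2 * recip_sum y" by simp
  have "2 * ln 30 = ln (30 ^ 2 :: real)" by (subst ln_realpow) auto
  also have "\<dots> \<le> ln (real y)" using y by simp
  finally have "ln (real y) \<le> 2 * ln (real y / 30)" using y by (simp add: ln_div)
  also have "ln (real y / 30) \<le> ln (real M + 1)"
  proof -
    have "y \<le> 30 * M" unfolding M_def by presburger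
    then have "real y \<le> 30 * real M" by linarith
    then show ?thesis using y by simp
  qed
  also have "ln (real M + 1) \<le> (\<Sum>m<M. 1 / real (m + 1))"
    using ln_le_harm[of M] by (simp add: harm_altdef inverse_eq_divide)
  also have "(\<Sum>m<M. 1 / real (m + 1)) \<le> (\<Sum>m<M. 30 * (1 / real (30 * m + 1)))"
    by (intro sum_mono) (simp add: field_simps)
  also have "\<dots> = 30 * (\<Sum>m<M. 1 / real (30 * m + 1))" by (simp add: sum_distrib_left)
  finally show ?thesis using le by simp
qed

lemma sum_Pow_inverse_prod:
  fixes H :: "nat set"
  assumes "finite H"
  shows "(\<Sum>E\<in>Pow H. 1 / real (\<Prod>E)) = (\<Prod>p\<in>H. 1 + 1 / real p)"
  using prod_add[OF assms, of "\<lambda>p. 1 / real p" "\<lambda>_. 1"]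
  by (simp add: prod_dividef add.commute)

text \<open>
  The primes above \<open>5\<close> for which the classes of \<open>0\<close> and \<open>-h\<close> coincide.
\<close>

definition sieve_primes :: "nat \<Rightarrow> nat set" where
  "sieve_primes h = {p. prime p \<and> 7 \<le> p \<and> p dvd h}"

lemma finite_sieve_primes: "h > 0 \<Longrightarrow> finite (sieve_primes h)"
  by (rule finite_subset[of _ "{..h}"]) (auto simp: sieve_primes_def dest: dvd_imp_le)

text \<open>
  A pair \<open>(A, B)\<close> of sets counted by the left-hand side is split into \<open>G = A \<inter> B\<close>, the set \<open>E\<close> of those
  primes of \<open>B - A\<close> that divide \<open>h\<close>, the remaining primes \<open>C\<close> of \<open>B - A\<close>, and \<open>D = (A - B) \<union> C\<close>.
  The pair is determined by \<open>(G, E, D, C)\<close>. For fixed \<open>D\<close> the number of admissible \<open>C\<close> is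
  the product of \<open>sieve_omega h p\<close> over \<open>p \<in> D\<close>, so the sum over \<open>D\<close> and \<open>C\<close> is at most \<open>sieve_sum h (y ^ 2)\<close>;
  the sum over \<open>G\<close> is at most \<open>2\<close> and the sum over \<open>E\<close> is the product over the primes dividing \<open>h\<close>.
\<close>

lemma recip_sum_square_le:
  assumes h: "h > 0"
  shows "recip_sum y ^ 2 \<le> 2 * (\<Prod>p\<in>sieve_primes h. 1 + 1 / real p) * sieve_sum h (y ^ 2)"
proof -
  define H where "H = sieve_primes h"
  have H: "finite H" unfolding H_def using h by (rule finite_sieve_primes)
  define T where "T = prime_sets y \<times> (Pow H \<times> (SIGMA D:prime_sets (y ^ 2). Pow (D - H)))"
  define w where "w = (\<lambda>(G, E, D, C::nat set).
      (1 / real (\<Prod>G) ^ 2) * ((1 / real (\<Prod>E)) * (1 / real (\<Prod>D))))"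
  define i where "i = (\<lambda>(G, E, D, C). ((G \<union> (D - C), G \<union> E \<union> C) :: nat set \<times> nat set))"
  have fin2: "finite (Pow (D - H))" if "D \<in> prime_sets (y ^ 2)" for D
    using prime_setsD(1)[OF that] by simp
  have finT: "finite T" unfolding T_def
    using H fin2 by (intro finite_cartesian_product finite_SigmaI finite_prime_sets) auto
  have "recip_sum y ^ 2
      = (\<Sum>(A, B)\<in>prime_sets y \<times> prime_sets y. (1 / real (\<Prod>A)) * (1 / real (\<Prod>B)))"
    by (simp add: recip_sum_def power2_eq_square sum_product sum.cartesian_product)
  also have "\<dots> \<le> (\<Sum>a\<in>T. w a)"
  proof (rule sum_le_included[where i = i])
    show "finite T" by (rule finT)
    show "\<forall>x\<in>prime_sets y \<times> prime_sets y. \<exists>a\<in>T. i a = x \<and>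
        (case x of (A, B) \<Rightarrow> (1 / real (\<Prod>A)) * (1 / real (\<Prod>B))) \<le> w a"
    proof
      fix x assume x: "x \<in> prime_sets y \<times> prime_sets y"
      then obtain A B where AB: "x = (A, B)" "A \<in> prime_sets y" "B \<in> prime_sets y" by auto
      note a = prime_setsD[OF AB(2)] and b = prime_setsD[OF AB(3)]
      define G where "G = A \<inter> B"
      define E where "E = (B - A) \<inter> H"
      define C where "C = (B - A) - H"
      define D where "D = (A - B) \<union> C"
      have A_eq: "\<Prod>A = \<Prod>G * \<Prod>(A - B)"
        using a(1) unfolding G_def by (subst prod.union_disjoint[symmetric]) (auto intro!: prod.cong)
      have B_eq: "\<Prod>B = \<Prod>G * (\<Prod>E * \<Prod>C)"
      proof -
        have "\<Prod>E * \<Prod>C = \<Prod>(B - A)"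
          using b(1) unfolding E_def C_def
          by (subst prod.union_disjoint[symmetric]) (auto intro!: prod.cong)
        moreover have "\<Prod>G * \<Prod>(B - A) = \<Prod>B"
          using b(1) unfolding G_def by (subst prod.union_disjoint[symmetric]) (auto intro!: prod.cong)
        ultimately show ?thesis by simp
      qed
      have D_eq: "\<Prod>D = \<Prod>(A - B) * \<Prod>C"
        unfolding D_def using a(1) b(1) by (intro prod.union_disjoint) (auto simp: C_def)
      have "\<Prod>G dvd \<Prod>A" "\<Prod>(A - B) dvd \<Prod>A" "\<Prod>C dvd \<Prod>B"
        unfolding A_eq B_eq by auto
      then have le: "\<Prod>G \<le> y" "\<Prod>(A - B) \<le> y" "\<Prod>C \<le> y"
        using a(4,5) b(4,5) by (auto dest!: dvd_imp_le)
      have G: "G \<in> prime_sets y" using a le by (auto simp: prime_sets_def G_def)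
      have "\<Prod>D \<le> y ^ 2" unfolding D_eq power2_eq_square using le(2,3) by (rule mult_le_mono)
      then have D: "D \<in> prime_sets (y ^ 2)"
        using a b by (auto simp: prime_sets_def D_def C_def)
      have "(G, E, D, C) \<in> T" using G D by (auto simp: T_def E_def C_def D_def)
      moreover have "i (G, E, D, C) = x" by (auto simp: i_def G_def E_def D_def C_def AB(1))
      moreover have "\<Prod>A * \<Prod>B = \<Prod>G ^ 2 * (\<Prod>E * \<Prod>D)"
        unfolding A_eq B_eq D_eq by (simp add: power2_eq_square)
      then have "real (\<Prod>A) * real (\<Prod>B) = real (\<Prod>G) ^ 2 * (real (\<Prod>E) * real (\<Prod>D))"
        by (metis of_nat_mult of_nat_power)
      then have "(1 / real (\<Prod>A)) * (1 / real (\<Prod>B)) = w (G, E, D, C)"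
        by (simp add: w_def)
      ultimately show "\<exists>a\<in>T. i a = x \<and>
        (case x of (A, B) \<Rightarrow> (1 / real (\<Prod>A)) * (1 / real (\<Prod>B))) \<le> w a"
        using AB(1) by (intro bexI[of _ "(G, E, D, C)"]) auto
    qed
  qed (auto simp: finite_prime_sets w_def intro!: mult_nonneg_nonneg prod_nonneg)
  also have "\<dots> = (\<Sum>G\<in>prime_sets y. 1 / real (\<Prod>G) ^ 2) * ((\<Sum>E\<in>Pow H. 1 / real (\<Prod>E)) *
      (\<Sum>D\<in>prime_sets (y ^ 2). \<Sum>C\<in>Pow (D - H). 1 / real (\<Prod>D)))"
  proof -
    have "(\<Sum>a\<in>T. w a) = (\<Sum>G\<in>prime_sets y. \<Sum>E\<in>Pow H. \<Sum>D\<in>prime_sets (y ^ 2). \<Sum>C\<in>Pow (D - H).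
        (1 / real (\<Prod>G) ^ 2) * ((1 / real (\<Prod>E)) * (1 / real (\<Prod>D))))"
      unfolding T_def w_def sum.cartesian_product' prod.case
      by (intro sum.cong refl, subst sum.Sigma) (auto simp: finite_prime_sets split_def dest: prime_setsD(1))
    also have "\<dots> = (\<Sum>G\<in>prime_sets y. (1 / real (\<Prod>G) ^ 2) * (\<Sum>E\<in>Pow H. (1 / real (\<Prod>E)) *
        (\<Sum>D\<in>prime_sets (y ^ 2). \<Sum>C\<in>Pow (D - H). 1 / real (\<Prod>D))))"
      by (simp only: sum_distrib_left)
    also have "\<dots> = (\<Sum>G\<in>prime_sets y. 1 / real (\<Prod>G) ^ 2) * ((\<Sum>E\<in>Pow H. 1 / real (\<Prod>E)) *
        (\<Sum>D\<in>prime_sets (y ^ 2). \<Sum>C\<in>Pow (D - H). 1 / real (\<Prod>D)))"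
      by (simp only: sum_distrib_right)
    finally show ?thesis .
  qed
  also have "\<dots> \<le> 2 * ((\<Prod>p\<in>H. 1 + 1 / real p) * sieve_sum h (y ^ 2))"
  proof (rule mult_mono)
    have "(\<Sum>G\<in>prime_sets y. 1 / real (\<Prod>G) ^ 2) \<le> (\<Sum>n=1..y. 1 / real n ^ 2)"
      by (rule sum_prime_sets_le) simp
    also have "\<dots> \<le> 2" by (rule sum_inverse_squares_le)
    finally show "(\<Sum>G\<in>prime_sets y. 1 / real (\<Prod>G) ^ 2) \<le> 2" .
    have "(\<Sum>D\<in>prime_sets (y ^ 2). \<Sum>C\<in>Pow (D - H). 1 / real (\<Prod>D)) \<le> sieve_sum h (y ^ 2)"
      unfolding sieve_sum_def
    proof (rule sum_mono)
      fix D assume D: "D \<in> prime_sets (y ^ 2)"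
      note d = prime_setsD[OF D]
      have DH: "D - H = D \<inter> {p. \<not> p dvd h}"
        using d(2,3) by (auto simp: H_def sieve_primes_def)
      have "(\<Sum>C\<in>Pow (D - H). 1 / real (\<Prod>D)) = 2 ^ card (D - H) / real (\<Prod>D)"
        using d(1) by (simp add: card_Pow)
      also have "2 ^ card (D - H) = (\<Prod>p\<in>D. sieve_omega h p)"
        unfolding sieve_omega_def DH using d(1)
        by (simp add: prod.If_cases Int_def Collect_neg_eq)
      also have "(\<Prod>p\<in>D. sieve_omega h p) / real (\<Prod>D) = (\<Prod>p\<in>D. sieve_omega h p / real p)"
        by (simp add: prod_dividef)
      also have "\<dots> \<le> (\<Prod>p\<in>D. sieve_g h p)"
        using d(3) sieve_g_bounds(3) by (intro prod_mono) (auto simp: sieve_omega_def)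
      finally show "(\<Sum>C\<in>Pow (D - H). 1 / real (\<Prod>D)) \<le> (\<Prod>p\<in>D. sieve_g h p)" .
    qed
    then show "(\<Sum>E\<in>Pow H. 1 / real (\<Prod>E)) *
        (\<Sum>D\<in>prime_sets (y ^ 2). \<Sum>C\<in>Pow (D - H). 1 / real (\<Prod>D))
      \<le> (\<Prod>p\<in>H. 1 + 1 / real p) * sieve_sum h (y ^ 2)"
      unfolding sum_Pow_inverse_prod[OF H] by (intro mult_left_mono prod_nonneg) auto
  qed (auto intro!: mult_nonneg_nonneg sum_nonneg prod_nonneg divide_nonneg_nonneg)
  finally show ?thesis by (simp add: H_def mult.assoc)
qed

lemma recip_sum_le_sieve_sum_0: "recip_sum y \<le> sieve_sum 0 y"
  unfolding recip_sum_def sieve_sum_def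
proof (rule sum_mono)
  fix A assume A: "A \<in> prime_sets y"
  have "1 / real (\<Prod>A) = (\<Prod>p\<in>A. sieve_omega 0 p / real p)"
    by (simp add: sieve_omega_def prod_dividef)
  also have "\<dots> \<le> (\<Prod>p\<in>A. sieve_g 0 p)"
  proof (rule prod_mono)
    fix p assume "p \<in> A"
    then show "0 \<le> sieve_omega 0 p / real p \<and> sieve_omega 0 p / real p \<le> sieve_g 0 p"
      using prime_setsD(3)[OF A] sieve_g_bounds(3)[of p 0] by (simp add: sieve_omega_def)
  qed
  finally show "1 / real (\<Prod>A) \<le> (\<Prod>p\<in>A. sieve_g 0 p)" .
qed

lemma recip_sum_mono: "y \<le> y' \<Longrightarrow> recip_sum y \<le> recip_sum y'"
  unfolding recip_sum_def
  by (intro sum_mono2 finite_prime_sets) (auto simp: prime_sets_def intro: prod_nonneg)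

lemma card_prime_pairs_le:
  assumes "z \<ge> 1"
  shows "real (card {p. p < N \<and> prime p \<and> prime (p + h)})
    \<le> real N / sieve_sum h z + real z + real z ^ 4"
proof -
  define S where "S = sieve_sum h z"
  define V where "V = {n. n < N \<and> (\<forall>p. prime p \<and> 7 \<le> p \<and> p \<le> z \<longrightarrow> \<not> p dvd n * (n + h))}"
  have S: "S \<ge> 1" unfolding S_def by (rule sieve_sum_ge_1[OF assms])
  have "{p. p < N \<and> prime p \<and> prime (p + h)} \<subseteq> {1..z} \<union> V"
  proof
    fix p assume p: "p \<in> {p. p < N \<and> prime p \<and> prime (p + h)}"
    have "\<not> q dvd p * (p + h)" if "prime q" "q \<le> z" "p > z" for q
      using that p by (auto simp: prime_dvd_mult_iff dest: primes_dvd_imp_eq)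
    then show "p \<in> {1..z} \<union> V" using p by (auto simp: V_def Suc_le_eq prime_gt_0_nat)
  qed
  then have "card {p. p < N \<and> prime p \<and> prime (p + h)} \<le> card ({1..z} \<union> V)"
    by (intro card_mono) (auto simp: V_def)
  also have "\<dots> \<le> z + card V" using card_Un_le[of "{1..z}" V] by simp
  finally have le: "real (card {p. p < N \<and> prime p \<and> prime (p + h)}) \<le> real z + real (card V)"
    by linarith
  have "S ^ 2 * real (card V) \<le> real N * S + real z ^ 4"
    unfolding S_def V_def by (rule sieve_bound[OF assms])
  then have "real (card V) \<le> (real N * S + real z ^ 4) / S ^ 2"
    using S by (simp add: field_simps)
  also have "\<dots> = real N / S + real z ^ 4 / S ^ 2"
    using S by (simp add: add_divide_distrib power2_eq_square)
  also have "real z ^ 4 / S ^ 2 \<le> real z ^ 4"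
    using S one_le_power[of S 2] by (simp add: divide_le_eq mult_le_cancel_left1)
  finally show ?thesis using le by (simp add: S_def)
qed

text \<open>The sieve parameter is \<open>z = y ^ 2\<close> with \<open>y\<close> the integer part of \<open>N powr (1/16)\<close>.\<close>

lemma sieve_parameter:
  "\<forall>\<^sub>F N in sequentially. \<exists>y::nat. y \<ge> 900 \<and> ln (real y) \<ge> ln (real N) / 32 \<and>
     real (y ^ 2) + real (y ^ 2) ^ 4 \<le> real N / ln (real N) ^ 2"
proof -
  have "\<forall>\<^sub>F N in sequentially. real N powr (1/32) \<ge> 900"
    "\<forall>\<^sub>F N in sequentially. real N powr (1/16) - 1 \<ge> real N powr (1/32)"
    "\<forall>\<^sub>F N in sequentially. 2 * real N powr (1/2) \<le> real N / ln (real N) ^ 2"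
    by real_asymp+
  then show ?thesis using eventually_ge_at_top[of 1]
  proof eventually_elim
    case (elim N)
    define y where "y = nat \<lfloor>real N powr (1/16)\<rfloor>"
    have "real y \<ge> real N powr (1/16) - 1" unfolding y_def by linarith
    then have y1: "real y \<ge> real N powr (1/32)" using elim by linarith
    have y2: "real y \<le> real N powr (1/16)" unfolding y_def by (simp add: powr_ge_zero)
    have "real y ^ 8 \<le> (real N powr (1/16)) ^ 8" using y2 by (intro power_mono) auto
    also have "\<dots> = real N powr (1/2)" using elim by (simp flip: powr_realpow add: powr_powr)
    finally have y8: "real y ^ 8 \<le> real N powr (1/2)" .
    have y900: "y \<ge> 900" using y1 elim by linarith
    have "real y ^ 2 \<le> real y ^ 8" using y900 by (intro power_increasing) auto
    then have "real (y ^ 2) + real (y ^ 2) ^ 4 \<le> 2 * real N powr (1/2)"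
      using y8 by (simp flip: power_mult)
    moreover have "ln (real y) \<ge> ln (real N powr (1/32))"
      using y1 elim by (intro ln_mono) auto
    ultimately show ?case using elim y900 by (intro exI[of _ y]) (auto simp: ln_powr)
  qed
qed

text \<open>
  The number of prime pairs with difference \<open>h\<close> is bounded by the expected order of magnitude, uniformly in \<open>h\<close>.
\<close>

lemma prime_pairs_upper:
  "\<exists>C>0. \<forall>\<^sub>F N in sequentially. \<forall>h>0.
     real (card {p. p < N \<and> prime p \<and> prime (p + h)})
       \<le> C * (\<Prod>p\<in>sieve_primes h. 1 + 1 / real p) * (real N / ln (real N) ^ 2)"
proof -
  define c :: real where "c = 1 / (32 * 120)"
  show ?thesis
  proof (rule exI[of _ "2 / c ^ 2 + 1"], intro conjI)
    show "\<forall>\<^sub>F N in sequentially. \<forall>h>0. real (card {p. p < N \<and> prime p \<and> prime (p + h)})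
       \<le> (2 / c ^ 2 + 1) * (\<Prod>p\<in>sieve_primes h. 1 + 1 / real p) * (real N / ln (real N) ^ 2)"
      using sieve_parameter eventually_gt_at_top[of 1]
    proof eventually_elim
      case (elim N)
      then obtain y where y: "y \<ge> 900" "ln (real y) \<ge> ln (real N) / 32"
        "real (y ^ 2) + real (y ^ 2) ^ 4 \<le> real N / ln (real N) ^ 2" by blast
      have ln: "ln (real N) > 0" using elim by simp
      show ?case
      proof (intro allI impI)
        fix h :: nat assume h: "h > 0"
        define B where "B = (\<Prod>p\<in>sieve_primes h. 1 + 1 / real p)"
        define S where "S = sieve_sum h (y ^ 2)"
        have B: "B \<ge> 1" unfolding B_def by (intro prod_ge_1) simp
        have "y ^ 2 \<ge> 1" using y by simp
        then have S: "S \<ge> 1" unfolding S_def by (rule sieve_sum_ge_1)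
        have "c * ln (real N) \<le> recip_sum y" using recip_sum_ge[OF y(1)] y(2) by (simp add: c_def)
        then have "(c * ln (real N)) ^ 2 \<le> recip_sum y ^ 2"
          using ln by (intro power_mono) (auto simp: c_def)
        also have "\<dots> \<le> 2 * B * S" unfolding B_def S_def using h by (rule recip_sum_square_le)
        finally have "1 / S \<le> 2 * B / (c * ln (real N)) ^ 2"
          using S ln by (simp add: field_simps c_def)
        then have "real N * (1 / S) \<le> real N * (2 * B / (c * ln (real N)) ^ 2)"
          by (intro mult_left_mono) auto
        moreover have "real (card {p. p < N \<and> prime p \<and> prime (p + h)})
            \<le> real N / S + real (y ^ 2) + real (y ^ 2) ^ 4"
          unfolding S_def by (rule card_prime_pairs_le) (use y in simp)
        ultimately have "real (card {p. p < N \<and> prime p \<and> prime (p + h)})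
            \<le> real N * (2 * B / (c * ln (real N)) ^ 2) + real N / ln (real N) ^ 2"
          using y(3) by simp
        also have "real N / ln (real N) ^ 2 \<le> B * (real N / ln (real N) ^ 2)"
          using B mult_right_mono[of 1 B "real N / ln (real N) ^ 2"] by simp
        also have "real N * (2 * B / (c * ln (real N)) ^ 2) + B * (real N / ln (real N) ^ 2)
            = (2 / c ^ 2 + 1) * B * (real N / ln (real N) ^ 2)"
          by (simp add: algebra_simps power_mult_distrib)
        finally show "real (card {p. p < N \<and> prime p \<and> prime (p + h)})
           \<le> (2 / c ^ 2 + 1) * (\<Prod>p\<in>sieve_primes h. 1 + 1 / real p) * (real N / ln (real N) ^ 2)"
          by (simp add: B_def)
      qed
    qed
  qed (simp add: c_def add_pos_pos)
qed

text \<open>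
  Chebyshev's upper bound is the sieve with \<open>h = 0\<close>, where a single class is removed for each prime.
\<close>

lemma primes_upper:
  "\<exists>C>0. \<forall>\<^sub>F N in sequentially. real (card {p. p < N \<and> prime p}) \<le> C * (real N / ln (real N))"
proof (rule exI[of _ 3841], intro conjI)
  have "\<forall>\<^sub>F N in sequentially. real N / ln (real N) ^ 2 \<le> real N / ln (real N)" by real_asymp
  then show "\<forall>\<^sub>F N in sequentially. real (card {p. p < N \<and> prime p}) \<le> 3841 * (real N / ln (real N))"
    using sieve_parameter eventually_gt_at_top[of 1]
  proof eventually_elim
    case (elim N)
    then obtain y where y: "y \<ge> 900" "ln (real y) \<ge> ln (real N) / 32"
      "real (y ^ 2) + real (y ^ 2) ^ 4 \<le> real N / ln (real N) ^ 2" by blast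
    have ln: "ln (real N) > 0" using elim by simp
    define S where "S = sieve_sum 0 (y ^ 2)"
    have "ln (real N) / 3840 \<le> recip_sum y" using recip_sum_ge[OF y(1)] y(2) by simp
    also have "\<dots> \<le> recip_sum (y ^ 2)" by (rule recip_sum_mono) (simp add: power2_nat_le_imp_le le_square power2_eq_square)
    also have "\<dots> \<le> S" unfolding S_def by (rule recip_sum_le_sieve_sum_0)
    finally have "real N / S \<le> real N / (ln (real N) / 3840)" using ln by (intro divide_left_mono) auto
    moreover have "real (card {p. p < N \<and> prime p \<and> prime (p + 0)})
        \<le> real N / S + real (y ^ 2) + real (y ^ 2) ^ 4"
      unfolding S_def by (rule card_prime_pairs_le) (use y in simp)
    ultimately show ?case using y(3) elim by simp
  qed
qed simp

section \<open>Chebyshev's lower bound\<close>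

lemma dvd_Lcm_prime_power:
  fixes p :: nat
  assumes "finite S" "prime p" "0 \<notin> S" "e > 0" "p ^ e dvd Lcm S"
  shows "\<exists>j\<in>S. p ^ e dvd j"
  using assms(1,3,5)
proof (induction S rule: finite_induct)
  case empty
  then show ?case using assms(2,4) by (auto simp: is_unit_power_iff)
next
  case (insert j S)
  have nz: "j \<noteq> 0" "Lcm S \<noteq> 0" using insert by (auto simp: Lcm_0_iff)
  have "p ^ e dvd lcm j (Lcm S)" using insert by simp
  then have "e \<le> multiplicity p (lcm j (Lcm S))"
    using nz assms(2) by (intro multiplicity_geI) (auto simp: lcm_eq_0_iff)
  then have "e \<le> multiplicity p j \<or> e \<le> multiplicity p (Lcm S)"
    using nz assms(2) by (auto simp: multiplicity_lcm max_def split: if_splits)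
  then show ?case using insert by (auto dest: multiplicity_dvd')
qed

text \<open>
  Every prime power in the factorization of the least common multiple of \<open>1, \<dots>, n\<close> is at most \<open>n\<close>.
\<close>

lemma Lcm_le_power_primes:
  fixes n :: nat
  assumes "n \<ge> 1"
  shows "Lcm {1..n} \<le> n ^ card {p. p \<le> n \<and> prime p}"
proof -
  define L :: nat where "L = Lcm {1..n}"
  have L0: "L \<noteq> 0" by (auto simp: L_def Lcm_0_iff)
  have bd: "p ^ multiplicity p L \<le> n" "p \<le> n" if "p \<in> prime_factors L" for p
  proof -
    have p: "prime p" "p dvd L" using that by auto
    then have "multiplicity p L > 0" using L0 by (simp add: prime_multiplicity_gt_zero_iff)
    then obtain j where j: "j \<in> {1..n}" "p ^ multiplicity p L dvd j"
      using dvd_Lcm_prime_power[of "{1..n}" p "multiplicity p L"] p multiplicity_dvd[of p L]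
      unfolding L_def by auto
    then show "p ^ multiplicity p L \<le> n" by (auto dest: dvd_imp_le)
    have "p dvd p ^ multiplicity p L" using \<open>multiplicity p L > 0\<close> by simp
    then have "p dvd j" using j(2) by (rule dvd_trans)
    then show "p \<le> n" using j(1) by (auto dest: dvd_imp_le)
  qed
  have "L = (\<Prod>p\<in>prime_factors L. p ^ multiplicity p L)"
    using L0 by (simp add: prod_prime_factors)
  also have "\<dots> \<le> (\<Prod>p\<in>prime_factors L. n)" using bd by (intro prod_mono) auto
  also have "\<dots> = n ^ card (prime_factors L)" by simp
  also have "\<dots> \<le> n ^ card {p. p \<le> n \<and> prime p}"
    using assms bd by (intro power_increasing card_mono) auto
  finally show ?thesis by (simp add: L_def)
qed

text \<open>
  The numbers \<open>1 / (m * (n choose m))\<close> form Leibniz' harmonic triangle; each of them is a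
  difference of two neighbours, so by induction on \<open>m\<close> the least common multiple of
  \<open>1, \<dots>, n\<close> is a common denominator.
\<close>

lemma Lcm_div_binomial_int:
  assumes "1 \<le> m" "m \<le> n"
  shows "real (Lcm {1..n}) / (real m * real (n choose m)) \<in> \<int>"
  using assms
proof (induction m arbitrary: n rule: nat_induct_at_least)
  case base
  have "n dvd Lcm {1..n}" using base by (intro dvd_Lcm) auto
  then show ?case by (auto elim!: dvdE simp: base)
next
  case (Suc m)
  obtain l where n: "n = Suc l" using Suc.prems by (cases n) auto
  have ml: "1 \<le> m" "m \<le> l" using Suc n by auto
  have b: "real (l choose m) > 0" using ml by simp
  have e1: "real (Suc m) * real (n choose Suc m) = real n * real (l choose m)"
    unfolding n by (metis Suc_times_binomial of_nat_mult)
  have "(n - m) * (n choose m) = n * (l choose m)"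
    using binomial_absorb_comp[of n m] n by simp
  then have e2: "(real n - real m) * real (n choose m) = real n * real (l choose m)"
    using ml n by (metis le_SucI of_nat_diff of_nat_mult)
  have nm: "real n - real m > 0" using ml n by simp
  have c: "real (n choose m) = real n * real (l choose m) / (real n - real m)"
    using e2 nm by (simp add: field_simps)
  have leib: "1 / (real (Suc m) * real (n choose Suc m))
      = 1 / (real m * real (l choose m)) - 1 / (real m * real (n choose m))"
  proof -
    have "1 / (N * B) = 1 / (M * B) - 1 / (M * (N * B / (N - M)))" if "0 < M" "M < N" "B > 0" for M N B :: real
    proof -
      have "1 / (M * (N * B / (N - M))) = (N - M) / (M * N * B)" by simp
      then show ?thesis using that by (simp add: field_simps)
    qed
    then show ?thesis unfolding e1 c using nm b ml by simp
  qed
  have "Lcm {1..l} dvd Lcm {1..n}" by (intro Lcm_subset) (auto simp: n)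
  then obtain q where q: "Lcm {1..n} = Lcm {1..l} * q" by blast
  have "real q * (real (Lcm {1..l}) / (real m * real (l choose m))) \<in> \<int>"
    using Suc.IH[of l] ml by (intro Ints_mult) auto
  moreover have "real (Lcm {1..n}) / (real m * real (n choose m)) \<in> \<int>"
    using Suc.IH[of n] ml n by auto
  ultimately have "real q * (real (Lcm {1..l}) / (real m * real (l choose m)))
      - real (Lcm {1..n}) / (real m * real (n choose m)) \<in> \<int>" by (rule Ints_diff)
  also have "real q * (real (Lcm {1..l}) / (real m * real (l choose m)))
      - real (Lcm {1..n}) / (real m * real (n choose m))
      = real (Lcm {1..n}) * (1 / (real m * real (l choose m)) - 1 / (real m * real (n choose m)))"
  proof -
    have "real (Lcm {1..n}) = real (Lcm {1..l}) * real q" unfolding q by (rule of_nat_mult)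
    moreover have "v * (u / x) - u * v / y = u * v * (1 / x - 1 / y)" for u v x y :: real
      by (simp add: algebra_simps)
    ultimately show ?thesis by simp
  qed
  finally show ?case unfolding leib[symmetric] by simp
qed

lemma Lcm_lower_bound:
  assumes "k \<ge> 1"
  shows "4 ^ k / 2 \<le> real (Lcm {1..2 * k})"
proof -
  define b where "b = real k * real ((2 * k) choose k)"
  have b: "b > 0" using assms by (simp add: b_def)
  have "Lcm {1..2 * k} \<noteq> (0 :: nat)" by (auto simp: Lcm_0_iff)
  then have "real (Lcm {1..2 * k}) > 0" by (simp only: of_nat_0_less_iff neq0_conv)
  then have "real (Lcm {1..2 * k}) / b > 0" using b by (rule divide_pos_pos)
  moreover have "real (Lcm {1..2 * k}) / b \<in> \<int>"
    unfolding b_def using assms by (intro Lcm_div_binomial_int) auto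
  ultimately have "real (Lcm {1..2 * k}) / b \<ge> 1"
    by (metis Ints_cases int_one_le_iff_zero_less of_int_0_less_iff of_int_1_le_iff)
  then have "b \<le> real (Lcm {1..2 * k})" using b by simp
  moreover have "4 ^ k / 2 \<le> b"
    using central_binomial_lower_bound[of k] assms by (simp add: b_def field_simps)
  ultimately show ?thesis by linarith
qed

lemma primes_lower:
  "\<forall>\<^sub>F N in sequentially. real N / ln (real N) / 2 \<le> real (card {p. p < N \<and> prime p})"
  using eventually_ge_at_top[of 14]
proof eventually_elim
  case (elim N)
  have "ln 4 = ln (2 ^ 2 :: real)" by simp
  also have "\<dots> = 2 * ln 2" by (subst ln_realpow) auto
  finally have "ln 4 \<ge> (4 / 3 :: real)" using ln2_ge_two_thirds by simp
  then have "(real N / 2 - 1) * (4 / 3) \<le> (real N / 2 - 1) * ln 4"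
    using elim by (intro mult_left_mono) auto
  moreover have "ln 2 \<le> (1 :: real)" using ln_le_minus_one[of 2] by simp
  ultimately have main: "real N / 2 \<le> (real N / 2 - 1) * ln 4 - ln 2" using elim by (simp add: field_simps)
  define k where "k = (N - 1) div 2"
  have k: "k \<ge> 1" "2 * k < N" "N \<le> 2 * k + 2" using elim by (auto simp: k_def)
  have ln: "ln (real N) > 0" using elim by simp
  define c where "c = card {p. p < N \<and> prime p}"
  have "(4 :: real) ^ k / 2 \<le> real (Lcm {1..2 * k})" by (rule Lcm_lower_bound[OF k(1)])
  also have "\<dots> \<le> real ((2 * k) ^ card {p. p \<le> 2 * k \<and> prime p})"
    using Lcm_le_power_primes[of "2 * k"] k by (simp only: of_nat_le_iff)
  also have "\<dots> \<le> real (N ^ c)"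
  proof -
    have "card {p. p \<le> 2 * k \<and> prime p} \<le> c"
      unfolding c_def using k by (intro card_mono) auto
    then have "(2 * k) ^ card {p. p \<le> 2 * k \<and> prime p} \<le> (2 * k) ^ c"
      using k by (intro power_increasing) auto
    also have "\<dots> \<le> N ^ c" using k by (intro power_mono) auto
    finally show ?thesis by (simp only: of_nat_le_iff)
  qed
  finally have "ln (4 ^ k / 2) \<le> ln (real (N ^ c))" by (intro ln_mono) auto
  then have "real k * ln 4 - ln 2 \<le> real c * ln (real N)"
    using elim by (simp add: ln_div ln_realpow)
  moreover have "(real N / 2 - 1) * ln 4 \<le> real k * ln 4"
    using k by (intro mult_right_mono) auto
  ultimately have "real N / 2 \<le> real c * ln (real N)" using main by linarith
  then show ?case using ln by (simp add: c_def field_simps)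
qed

section \<open>Coincidences among the floors modulo a prime\<close>

lemma lucas_square_diff:
  assumes "l \<le> k" "even k \<longleftrightarrow> even l"
  shows "lucas k ^ 2 - lucas l ^ 2 = 5 * int (fib (k + l)) * int (fib (k - l))"
proof -
  define a b where "a = \<phi>" and "b = golden_conj"
  have ab: "a * b = -1" unfolding a_def b_def by (rule golden_mult_conj)
  define d where "d = k - l"
  have k: "k = l + d" and d: "even d" using assms by (auto simp: d_def)
  have abp: "a ^ n * b ^ n = (-1) ^ n" for n by (simp flip: power_mult_distrib add: ab)
  have "(a ^ k + b ^ k) ^ 2 - (a ^ l + b ^ l) ^ 2 = (a ^ (k + l) - b ^ (k + l)) * (a ^ d - b ^ d)"
  proof -
    have ad: "a ^ d * b ^ d = 1" using abp[of d] d by simp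
    have "(a ^ k + b ^ k) ^ 2 - (a ^ l + b ^ l) ^ 2 - (a ^ (k + l) - b ^ (k + l)) * (a ^ d - b ^ d)
        = ((a ^ d * b ^ d) - 1) * (a ^ l + b ^ l) ^ 2"
      unfolding k power_add by (simp add: algebra_simps power2_eq_square)
    then show ?thesis unfolding ad by simp
  qed
  then have "real_of_int (lucas k ^ 2 - lucas l ^ 2)
      = (sqrt 5 * real (fib (k + l))) * (sqrt 5 * real (fib (k - l)))"
    unfolding fib_eq_golden a_def b_def d_def by (simp add: lucas_eq_golden)
  also have "\<dots> = real_of_int (5 * int (fib (k + l)) * int (fib (k - l)))" by simp
  finally show ?thesis by (simp only: of_int_eq_iff)
qed

text \<open>
  The rank of apparition of \<open>p\<close> in the Fibonacci sequence, with the value \<open>p\<close> for a number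
  that divides no Fibonacci number of positive index.
\<close>

definition fib_rank :: "nat \<Rightarrow> nat" where
  "fib_rank p = (if \<exists>j\<ge>1. p dvd fib j then LEAST j. j \<ge> 1 \<and> p dvd fib j else p)"

lemma fib_rank_cases:
  assumes "p \<ge> 1"
  shows "fib_rank p \<ge> 1" "fib_rank p = p \<or> p dvd fib (fib_rank p)"
proof -
  have "fib_rank p \<ge> 1 \<and> (fib_rank p = p \<or> p dvd fib (fib_rank p))"
  proof (cases "\<exists>j\<ge>1. p dvd fib j")
    case True
    then have "(LEAST j. j \<ge> 1 \<and> p dvd fib j) \<ge> 1 \<and> p dvd fib (LEAST j. j \<ge> 1 \<and> p dvd fib j)"
      by (rule LeastI_ex)
    then show ?thesis using True by (simp add: fib_rank_def)
  next
    case False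
    then have "fib_rank p = p" unfolding fib_rank_def by (rule if_not_P)
    then show ?thesis using assms by simp
  qed
  then show "fib_rank p \<ge> 1" "fib_rank p = p \<or> p dvd fib (fib_rank p)" by auto
qed

lemma fib_rank_dvd:
  assumes "p dvd fib j" "j \<ge> 1"
  shows "fib_rank p dvd j"
proof -
  have ex: "\<exists>j\<ge>1. p dvd fib j" using assms by blast
  define z where "z = fib_rank p"
  have z: "z = (LEAST j. j \<ge> 1 \<and> p dvd fib j)" using ex by (simp add: z_def fib_rank_def)
  have zz: "z \<ge> 1" "p dvd fib z" unfolding z using LeastI_ex[OF ex] by auto
  have "p dvd fib (gcd z j)" unfolding fib_gcd using zz(2) assms(1) by (rule gcd_greatest)
  moreover have "gcd z j \<ge> 1" using zz(1) by (simp add: Suc_le_eq gcd_pos_nat)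
  ultimately have "z \<le> gcd z j" unfolding z by (intro Least_le) (simp flip: z)
  then have "gcd z j = z" using zz(1) by (intro antisym gcd_le1_nat) auto
  then show ?thesis unfolding z_def by (metis gcd_dvd2)
qed

text \<open>
  If \<open>p\<close> divides the difference of two Lucas numbers whose indices have the same parity, it divides the
  difference of their squares, which is five times a product of two Fibonacci numbers.
\<close>

lemma lucas_cong_imp:
  assumes p: "prime p" "p > 5" and kl: "l \<ge> 1" "l \<le> k" "even k \<longleftrightarrow> even l"
    and dvd: "int p dvd lucas k - lucas l"
  shows "fib_rank p dvd k + l \<or> fib_rank p dvd k - l"
proof (cases "k = l")
  case False
  have "int p dvd (lucas k - lucas l) * (lucas k + lucas l)" using dvd by (rule dvd_mult2)
  also have "\<dots> = int (5 * fib (k + l) * fib (k - l))"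
    using lucas_square_diff[OF kl(2,3)] by (simp add: algebra_simps power2_eq_square)
  finally have "p dvd 5 * fib (k + l) * fib (k - l)" by (simp only: int_dvd_int_iff)
  moreover have "\<not> p dvd 5" using p(2) by (auto dest: dvd_imp_le)
  ultimately have "p dvd fib (k + l) \<or> p dvd fib (k - l)"
    using p(1) by (simp add: prime_dvd_mult_iff)
  then show ?thesis using False kl by (auto dest: fib_rank_dvd)
qed simp

text \<open>
  The floors of the powers of the golden ratio as natural numbers.
\<close>

definition gfloor :: "nat \<Rightarrow> nat" where
  "gfloor k = nat \<lfloor>\<phi> ^ k\<rfloor>"

lemma int_gfloor: "int (gfloor k) = \<lfloor>\<phi> ^ k\<rfloor>"
  using golden_bounds by (simp add: gfloor_def)

lemma gfloor_le: "gfloor k \<le> 2 ^ k"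
proof -
  have "\<phi> ^ k \<le> 2 ^ k" using golden_bounds by (intro power_mono) auto
  then have "real_of_int (int (gfloor k)) \<le> 2 ^ k" unfolding int_gfloor by linarith
  then have "real (gfloor k) \<le> real (2 ^ k)" by simp
  then show ?thesis by (simp only: of_nat_le_iff)
qed

lemma gfloor_pos: "gfloor k \<ge> 1"
proof -
  have "\<phi> ^ k \<ge> 1" using golden_bounds by (intro one_le_power) auto
  then have "int (gfloor k) \<ge> 1" unfolding int_gfloor by (simp add: le_floor_iff)
  then show ?thesis by simp
qed

lemma gfloor_less:
  assumes "1 \<le> l" "l < k"
  shows "gfloor l < gfloor k"
proof -
  have "\<phi> ^ l + 1 \<le> \<phi> ^ Suc l"
  proof -
    obtain j where j: "l = Suc j" using assms by (cases l) auto
    have "\<phi> ^ Suc l = \<phi> ^ j * \<phi> ^ 2" by (simp add: j power2_eq_square)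
    also have "\<dots> = \<phi> ^ l + \<phi> ^ j" by (simp add: golden_ratio_square j algebra_simps)
    also have "\<phi> ^ j \<ge> 1" using golden_bounds by (intro one_le_power) auto
    then have "\<phi> ^ l + \<phi> ^ j \<ge> \<phi> ^ l + 1" by simp
    finally show ?thesis by simp
  qed
  also have "\<phi> ^ Suc l \<le> \<phi> ^ k" using assms golden_bounds by (intro power_increasing) auto
  finally have "\<lfloor>\<phi> ^ l\<rfloor> < \<lfloor>\<phi> ^ k\<rfloor>" by linarith
  then show ?thesis unfolding int_gfloor[symmetric] by simp
qed

lemma card_same_residue_le:
  assumes "m \<ge> 1" "Y \<subseteq> {..K}" "\<And>a b. a \<in> Y \<Longrightarrow> b \<in> Y \<Longrightarrow> a mod m = b mod (m::nat)"
  shows "card Y \<le> K div m + 1"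
proof -
  have "inj_on (\<lambda>a. a div m) Y"
    by (intro inj_onI) (metis assms(3) div_mult_mod_eq)
  then have "card Y = card ((\<lambda>a. a div m) ` Y)" by (simp add: card_image)
  also have "\<dots> \<le> card {..K div m}" using assms by (intro card_mono) (auto intro: div_le_mono)
  finally show ?thesis by simp
qed

text \<open>
  Among the indices of a fixed parity all solutions are congruent, up to sign, to any one of
  them modulo the rank of apparition. This makes at most four residue classes.
\<close>

lemma card_coincidences_le:
  assumes p: "prime p" "p > 5"
  shows "card {k \<in> {1..K}. int p dvd \<lfloor>\<phi> ^ k\<rfloor> - c} \<le> 4 * (K div fib_rank p + 1)"
proof -
  define m where "m = fib_rank p"
  have m: "m \<ge> 1" unfolding m_def using p by (intro fib_rank_cases) auto
  define X where "X e = {k \<in> {1..K}. int p dvd \<lfloor>\<phi> ^ k\<rfloor> - c \<and> (even k \<longleftrightarrow> e)}" for e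
  have X: "card (X e) \<le> 2 * (K div m + 1)" for e
  proof (cases "X e = {}")
    case False
    then obtain k0 where k0: "k0 \<in> X e" by blast
    define Y where "Y = {k \<in> X e. k mod m = k0 mod m}"
    define Z where "Z = {k \<in> X e. m dvd k + k0}"
    have "X e \<subseteq> Y \<union> Z"
    proof
      fix k assume k: "k \<in> X e"
      have par: "even k \<longleftrightarrow> even k0" and ge: "k \<ge> 1" "k0 \<ge> 1" using k k0 by (auto simp: X_def)
      have "int p dvd (\<lfloor>\<phi> ^ k\<rfloor> - c) - (\<lfloor>\<phi> ^ k0\<rfloor> - c)"
        by (rule dvd_diff) (use k k0 in \<open>auto simp: X_def\<close>)
      then have d: "int p dvd lucas k - lucas k0"
        using par by (simp add: floor_golden_power[OF ge(1)] floor_golden_power[OF ge(2)])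
      have "m dvd k + k0 \<or> k mod m = k0 mod m"
      proof (cases "k0 \<le> k")
        case True
        then have "m dvd k + k0 \<or> m dvd k - k0"
          unfolding m_def using p ge par d by (intro lucas_cong_imp) auto
        then show ?thesis using True by (auto simp: mod_eq_dvd_iff_nat)
      next
        case False
        have "int p dvd lucas k0 - lucas k" using d by (simp add: dvd_diff_commute)
        then have "m dvd k0 + k \<or> m dvd k0 - k"
          unfolding m_def using False p ge par by (intro lucas_cong_imp) auto
        then show ?thesis using False mod_eq_dvd_iff_nat[of k k0 m] by (auto simp: add.commute)
      qed
      then show "k \<in> Y \<union> Z" using k by (auto simp: Y_def Z_def)
    qed
    then have "card (X e) \<le> card (Y \<union> Z)"
      by (intro card_mono) (auto simp: Y_def Z_def X_def)
    also have "\<dots> \<le> card Y + card Z" by (rule card_Un_le)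
    also have "card Y \<le> K div m + 1"
      using m by (rule card_same_residue_le) (auto simp: Y_def X_def)
    also have "card Z \<le> K div m + 1"
    proof (rule card_same_residue_le[OF m])
      fix a b assume "a \<in> Z" "b \<in> Z"
      then have "(a + k0) mod m = (b + k0) mod m" by (auto simp: Z_def dvd_eq_mod_eq_0)
      then show "a mod m = b mod m" by (simp add: nat_mod_eq_iff)
    qed (auto simp: Z_def X_def)
    finally show ?thesis by simp
  qed simp
  have "{k \<in> {1..K}. int p dvd \<lfloor>\<phi> ^ k\<rfloor> - c} = X True \<union> X False"
    by (auto simp: X_def)
  then have "card {k \<in> {1..K}. int p dvd \<lfloor>\<phi> ^ k\<rfloor> - c} \<le> card (X True) + card (X False)"
    by (simp add: card_Un_le)
  also have "\<dots> \<le> 4 * (K div m + 1)" using X[of True] X[of False] by simp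
  finally show ?thesis by (simp add: m_def)
qed

section \<open>The singular series on average\<close>

text \<open>
  Expansion of the product according to the largest factor \<open>1 / q\<close> that is chosen.
\<close>

lemma prod_by_largest_factor:
  assumes "finite S"
  shows "(\<Prod>p\<in>S. 1 + 1 / real p) = 1 + (\<Sum>q\<in>S. 1 / real q * (\<Prod>p\<in>{p\<in>S. p < q}. 1 + 1 / real p))"
  using assms
proof (induction S rule: finite_linorder_max_induct)
  case (insert b S)
  have b: "b \<notin> S" using insert.hyps by auto
  have 1: "{p \<in> insert b S. p < b} = S" using insert.hyps by auto
  have 2: "{p \<in> insert b S. p < q} = {p \<in> S. p < q}" if "q \<in> S" for q
    using insert.hyps that by auto
  have "(\<Sum>q\<in>insert b S. 1 / real q * (\<Prod>p\<in>{p\<in>insert b S. p < q}. 1 + 1 / real p))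
      = 1 / real b * (\<Prod>p\<in>S. 1 + 1 / real p) + (\<Sum>q\<in>S. 1 / real q * (\<Prod>p\<in>{p\<in>S. p < q}. 1 + 1 / real p))"
  proof -
    have "(\<Sum>q\<in>S. 1 / real q * (\<Prod>p\<in>{p\<in>insert b S. p < q}. 1 + 1 / real p))
        = (\<Sum>q\<in>S. 1 / real q * (\<Prod>p\<in>{p\<in>S. p < q}. 1 + 1 / real p))"
      by (rule sum.cong[OF refl]) (simp only: 2)
    then show ?thesis unfolding sum.insert[OF insert.hyps(1) b] 1 by simp
  qed
  then show ?case using insert b by (simp add: algebra_simps)
qed simp

lemma prime_mod_6:
  assumes "prime p" "p > (3::nat)"
  shows "p mod 6 \<in> {1, 5}"
proof -
  have "\<not> 2 dvd p" "\<not> 3 dvd p" using assms primes_dvd_imp_eq[of 2 p] primes_dvd_imp_eq[of 3 p] by auto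
  then have "p mod 6 \<noteq> 0 \<and> p mod 6 \<noteq> 2 \<and> p mod 6 \<noteq> 3 \<and> p mod 6 \<noteq> 4" by presburger
  moreover have "p mod 6 < 6" by simp
  ultimately have "p mod 6 = 1 \<or> p mod 6 = 5" by linarith
  then show ?thesis by simp
qed

text \<open>
  Primes above \<open>3\<close> are coprime to \<open>6\<close>. One third of the integers are, so the product grows like a
  cube root: \<open>(1 + 1 / j) ^ 3\<close> is at most the product \<open>(j + 1) / (j - 2)\<close> of \<open>1 + 1 / i\<close> over \<open>i = j, j - 1, j - 2\<close>,
  and the two new factors in a step from \<open>m\<close> to \<open>m + 1\<close> contribute at most \<open>(3 * m + 7) / (3 * m + 4)\<close>.
\<close>

lemma prod_coprime_6_le:
  "(\<Prod>j | 7 \<le> j \<and> j \<le> 6 * m + 7 \<and> j mod 6 \<in> {1, 5}. 1 + 1 / real j) ^ 3 \<le> 3 * real m + 4"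
proof (induction m)
  case 0
  have "{j. 7 \<le> j \<and> j \<le> 6 * 0 + 7 \<and> j mod 6 \<in> {1, 5}} = {7::nat}" by auto
  then show ?case by (simp add: power3_eq_cube)
next
  case (Suc m)
  define F where "F m = {j. 7 \<le> j \<and> j \<le> 6 * m + 7 \<and> j mod 6 \<in> {1, 5::nat}}" for m
  have fin: "finite (F m)" for m by (rule finite_subset[of _ "{..6 * m + 7}"]) (auto simp: F_def)
  have F_Suc: "F (Suc m) = insert (6 * m + 11) (insert (6 * m + 13) (F m))"
  proof -
    have "j = 6 * m + 11 \<or> j = 6 * m + 13 \<or> j \<le> 6 * m + 7"
      if "j \<in> F (Suc m)" for j
    proof -
      have "j \<le> 6 * m + 13" "j mod 6 = 1 \<or> j mod 6 = 5" using that by (auto simp: F_def)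
      then show ?thesis by presburger
    qed
    then have "F (Suc m) \<subseteq> insert (6 * m + 11) (insert (6 * m + 13) (F m))"
      by (auto simp: F_def)
    moreover have "(6 * m + 11) mod 6 = 5" "(6 * m + 13) mod 6 = 1" by presburger+
    then have "insert (6 * m + 11) (insert (6 * m + 13) (F m)) \<subseteq> F (Suc m)"
      by (auto simp: F_def)
    ultimately show ?thesis by (rule equalityI)
  qed
  define x where "x = real m"
  have x: "x \<ge> 0" by (simp add: x_def)
  have cube: "(1 + 1 / y) ^ 3 \<le> a / b" if "y > 2" "a = y + 1" "b = y - 2" for y a b :: real
  proof -
    have "(1 + 1 / y) ^ 3 = (y + 1) * (y + 1) ^ 2 / y ^ 3"
      using that by (simp add: field_simps power2_eq_square power3_eq_cube)
    also have "\<dots> \<le> (y + 1) / (y - 2)"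
    proof -
      have "(y + 1) ^ 2 * (y - 2) \<le> y ^ 3"
        using that by (simp add: power2_eq_square power3_eq_cube algebra_simps)
      then have "(y + 1) * ((y + 1) ^ 2 * (y - 2)) \<le> (y + 1) * y ^ 3"
        using that by (intro mult_left_mono) auto
      then show ?thesis using that by (simp add: divide_simps mult.assoc)
    qed
    finally show ?thesis using that by simp
  qed
  have c1: "(1 + 1 / (6 * x + 11)) ^ 3 \<le> (6 * x + 12) / (6 * x + 9)" by (rule cube) (use x in auto)
  have c2: "(1 + 1 / (6 * x + 13)) ^ 3 \<le> (6 * x + 14) / (6 * x + 11)" by (rule cube) (use x in auto)
  have "(\<Prod>j\<in>F (Suc m). 1 + 1 / real j) = (1 + 1 / (6 * x + 11)) * ((1 + 1 / (6 * x + 13)) * (\<Prod>j\<in>F m. 1 + 1 / real j))"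
    unfolding F_Suc using fin by (simp add: F_def x_def)
  then have "(\<Prod>j\<in>F (Suc m). 1 + 1 / real j) ^ 3
      = (1 + 1 / (6 * x + 11)) ^ 3 * ((1 + 1 / (6 * x + 13)) ^ 3 * (\<Prod>j\<in>F m. 1 + 1 / real j) ^ 3)"
    by (simp only: power_mult_distrib)
  also have "\<dots> \<le> (6 * x + 12) / (6 * x + 9) * ((6 * x + 14) / (6 * x + 11) * (3 * x + 4))"
    using x Suc by (intro mult_mono c1 c2) (auto simp: F_def x_def intro!: mult_nonneg_nonneg zero_le_power prod_nonneg)
  also have "\<dots> \<le> 3 * x + 7"
  proof -
    have "(6 * x + 12) * ((6 * x + 14) * (3 * x + 4)) \<le> (3 * x + 7) * ((6 * x + 9) * (6 * x + 11))"
      using x by (simp add: algebra_simps)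
    then show ?thesis using x by (simp add: divide_simps mult.assoc)
  qed
  finally show ?case by (simp add: F_def x_def)
qed

lemma prod_primes_below_le:
  assumes "S \<subseteq> {p. prime p \<and> 7 \<le> p \<and> p < q}" "q \<ge> 7"
  shows "(\<Prod>p\<in>S. 1 + 1 / real p) \<le> real q powr (1/3)"
proof -
  define m where "m = (q - 3) div 6"
  define F where "F = {j. 7 \<le> j \<and> j \<le> 6 * m + 7 \<and> j mod 6 \<in> {1, 5::nat}}"
  have m: "q \<le> 6 * m + 8" "3 * m + 4 \<le> q" using assms(2) unfolding m_def by presburger+
  have fin: "finite F" by (rule finite_subset[of _ "{..6 * m + 7}"]) (auto simp: F_def)
  have "S \<subseteq> F"
  proof
    fix p assume "p \<in> S"
    then have "prime p" "7 \<le> p" "p < q" using assms(1) by auto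
    then show "p \<in> F" using prime_mod_6[of p] m by (simp add: F_def)
  qed
  then have "(\<Prod>p\<in>S. 1 + 1 / real p) \<le> (\<Prod>p\<in>F. 1 + 1 / real p)"
    using fin by (intro prod_mono2) auto
  moreover have "(\<Prod>p\<in>S. 1 + 1 / real p) \<ge> 0" by (intro prod_nonneg) auto
  ultimately have "(\<Prod>p\<in>S. 1 + 1 / real p) ^ 3 \<le> (\<Prod>p\<in>F. 1 + 1 / real p) ^ 3"
    by (intro power_mono) auto
  also have "\<dots> \<le> 3 * real m + 4" unfolding F_def by (rule prod_coprime_6_le)
  also have "\<dots> \<le> real q" using m(2) by linarith
  also have "\<dots> = (real q powr (1/3)) ^ 3" using assms(2) by (simp flip: powr_realpow add: powr_powr)
  finally show ?thesis by (rule power_mono_iff[THEN iffD1, rotated -1]) (auto intro: prod_nonneg)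
qed

text \<open>
  Fewer than \<open>K\<close> primes above \<open>K\<close> divide \<open>h\<close>, which changes the product by a factor of at most
  \<open>exp 1\<close>. The product over the primes up to \<open>K\<close> is expanded according to the largest prime.
\<close>

lemma prod_sieve_primes_le:
  assumes h: "0 < h" "h < 2 ^ K" and K: "K \<ge> 1"
  shows "(\<Prod>p\<in>sieve_primes h. 1 + 1 / real p)
    \<le> 3 * (1 + (\<Sum>p\<in>{p \<in> sieve_primes h. p \<le> K}. real p powr (-2/3)))"
proof -
  define S where "S = {p \<in> sieve_primes h. p \<le> K}"
  define L where "L = {p \<in> sieve_primes h. p > K}"
  have fin: "finite S" "finite L" using finite_sieve_primes[OF h(1)] by (auto simp: S_def L_def)
  have prL: "\<And>p. p \<in> L \<Longrightarrow> prime p" by (auto simp: L_def sieve_primes_def)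
  have "\<Prod>L dvd h"
    using fin(2) by (intro prod_primes_dvd) (auto simp: L_def sieve_primes_def)
  then have "\<Prod>L \<le> h" using h(1) by (rule dvd_imp_le)
  moreover have "2 ^ card L \<le> \<Prod>L"
  proof -
    have "(\<Prod>p\<in>L. 2) \<le> \<Prod>L" using prL by (intro prod_mono) (auto simp: prime_ge_2_nat)
    then show ?thesis by simp
  qed
  ultimately have "2 ^ card L < (2::nat) ^ K" using h(2) by linarith
  then have cL: "card L < K" by simp
  have "(\<Prod>p\<in>L. 1 + 1 / real p) \<le> (\<Prod>p\<in>L. 1 + 1 / real K)"
    using K by (intro prod_mono) (auto simp: L_def intro!: divide_left_mono)
  also have "\<dots> = (1 + 1 / real K) ^ card L" by simp
  also have "\<dots> \<le> (1 + 1 / real K) ^ K" using cL by (intro power_increasing) auto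
  also have "\<dots> \<le> exp (1 / real K) ^ K" by (intro power_mono exp_ge_add_one_self) auto
  also have "\<dots> = exp 1" using K by (simp flip: exp_of_nat_mult)
  also have "\<dots> \<le> 3" by (rule exp_le)
  finally have L3: "(\<Prod>p\<in>L. 1 + 1 / real p) \<le> 3" .
  have "(\<Prod>p\<in>S. 1 + 1 / real p) = 1 + (\<Sum>q\<in>S. 1 / real q * (\<Prod>p\<in>{p\<in>S. p < q}. 1 + 1 / real p))"
    by (rule prod_by_largest_factor[OF fin(1)])
  also have "\<dots> \<le> 1 + (\<Sum>q\<in>S. real q powr (-2/3))"
  proof (intro add_left_mono sum_mono)
    fix q assume q: "q \<in> S"
    then have q7: "q \<ge> 7" by (simp add: S_def sieve_primes_def)
    have "(\<Prod>p\<in>{p\<in>S. p < q}. 1 + 1 / real p) \<le> real q powr (1/3)"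
      using q7 by (intro prod_primes_below_le) (auto simp: S_def sieve_primes_def)
    then have "1 / real q * (\<Prod>p\<in>{p\<in>S. p < q}. 1 + 1 / real p) \<le> real q powr (-1) * real q powr (1/3)"
      using q7 by (intro mult_mono prod_nonneg) (auto simp: powr_minus_divide)
    also have "\<dots> = real q powr (-1 + 1/3)" by (rule powr_add[symmetric])
    also have "-1 + 1/3 = (-2/3 :: real)" by simp
    finally show "1 / real q * (\<Prod>p\<in>{p\<in>S. p < q}. 1 + 1 / real p) \<le> real q powr (-2/3)" .
  qed
  finally have S1: "(\<Prod>p\<in>S. 1 + 1 / real p) \<le> 1 + (\<Sum>q\<in>S. real q powr (-2/3))" .
  have "sieve_primes h = L \<union> S" by (auto simp: L_def S_def)
  moreover have "L \<inter> S = {}" by (auto simp: L_def S_def)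
  ultimately have "(\<Prod>p\<in>sieve_primes h. 1 + 1 / real p) = (\<Prod>p\<in>L. 1 + 1 / real p) * (\<Prod>p\<in>S. 1 + 1 / real p)"
    using prod.union_disjoint[OF fin(2,1)] by simp
  also have "\<dots> \<le> 3 * (1 + (\<Sum>q\<in>S. real q powr (-2/3)))"
    using L3 S1 by (intro mult_mono prod_nonneg) auto
  finally show ?thesis by (simp add: S_def)
qed

lemma card_prime_factors_fib_le: "card (prime_factors (fib r)) \<le> r"
proof (cases "r = 0")
  case False
  then have pos: "fib r > 0" by (simp add: fib_neq_0_nat)
  have "2 ^ card (prime_factors (fib r)) = (\<Prod>p\<in>prime_factors (fib r). 2 :: nat)" by simp
  also have "\<dots> \<le> \<Prod>(prime_factors (fib r))"
    by (intro prod_mono) (auto simp: prime_ge_2_nat in_prime_factors_iff)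
  also have "\<dots> \<le> fib r"
    using pos by (intro dvd_imp_le prod_primes_dvd) (auto simp: in_prime_factors_iff)
  also have "fib r < 2 ^ r"
    by (induction r rule: fib.induct) auto
  finally show ?thesis by simp
qed simp

text \<open>
  Let \<open>r = min p (fib_rank p)\<close>. A prime \<open>p \<le> r ^ 2\<close> contributes at most \<open>p powr (-7/6)\<close> to the
  following sum. A prime \<open>p > r ^ 2\<close> divides the \<open>r\<close>-th Fibonacci number, which has at most \<open>r\<close>
  prime factors, so those with the same value of \<open>r\<close> together contribute at most \<open>r powr (-4/3)\<close>.
\<close>

lemma sum_primes_fib_rank_bounded:
  "\<exists>C>0. \<forall>K. (\<Sum>p | prime p \<and> 7 \<le> p \<and> p \<le> K. real p powr (-2/3) / real (min p (fib_rank p))) \<le> C"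
proof -
  define r where "r p = min p (fib_rank p)" for p
  have sum1: "summable (\<lambda>n. real n powr (-7/6))" and sum2: "summable (\<lambda>n. real n powr (-4/3))"
    by (simp_all add: summable_real_powr_iff)
  define C1 where "C1 = (\<Sum>n. real n powr (-7/6))"
  define C2 where "C2 = (\<Sum>n. real n powr (-4/3))"
  have C: "C1 \<ge> 0" "C2 \<ge> 0" unfolding C1_def C2_def by (intro suminf_nonneg sum1 sum2; simp)+
  have "(\<Sum>p | prime p \<and> 7 \<le> p \<and> p \<le> K. real p powr (-2/3) / real (r p)) \<le> C1 + C2" for K
  proof -
    define P where "P = {p. prime p \<and> 7 \<le> p \<and> p \<le> K}"
    have finP: "finite P" by (rule finite_subset[of _ "{..K}"]) (auto simp: P_def)
    have r: "r p \<ge> 1" "r p \<le> K" "r p = p \<or> p \<in> prime_factors (fib (r p))" if "p \<in> P" for p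
    proof -
      have p: "prime p" "p \<ge> 1" "p \<le> K" using that by (auto simp: P_def)
      have k: "fib_rank p \<ge> 1" "fib_rank p = p \<or> p dvd fib (fib_rank p)"
        using fib_rank_cases[OF p(2)] by auto
      show "r p \<ge> 1" "r p \<le> K" using p k by (auto simp: r_def)
      show "r p = p \<or> p \<in> prime_factors (fib (r p))"
        using p k by (auto simp: r_def min_def in_prime_factors_iff fib_neq_0_nat)
    qed
    have "(\<Sum>p\<in>{p \<in> P. p \<le> r p ^ 2}. real p powr (-2/3) / real (r p))
        \<le> (\<Sum>p\<in>{p \<in> P. p \<le> r p ^ 2}. real p powr (-7/6))"
    proof (rule sum_mono)
      fix p assume p: "p \<in> {p \<in> P. p \<le> r p ^ 2}"
      then have p7: "p \<ge> 7" and sq: "real p \<le> real (r p) ^ 2"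
        by (auto simp: P_def simp flip: of_nat_power)
      have "real p powr (1/2) \<le> real (r p)"
        using sq by (simp add: powr_half_sqrt real_le_lsqrt)
      then have "real p powr (-2/3) / real (r p) \<le> real p powr (-2/3) / real p powr (1/2)"
        using p7 r(1)[of p] p by (intro divide_left_mono mult_pos_pos) auto
      also have "\<dots> = real p powr (-7/6)" by (simp flip: powr_diff)
      finally show "real p powr (-2/3) / real (r p) \<le> real p powr (-7/6)" .
    qed
    also have "\<dots> \<le> C1"
      unfolding C1_def using finP by (intro sum_le_suminf sum1) auto
    finally have part1: "(\<Sum>p\<in>{p \<in> P. p \<le> r p ^ 2}. real p powr (-2/3) / real (r p)) \<le> C1" .
    define T where "T = (SIGMA t:{1..K}. prime_factors (fib t))"
    have "(\<Sum>p\<in>{p \<in> P. \<not> p \<le> r p ^ 2}. real p powr (-2/3) / real (r p))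
        \<le> (\<Sum>(t, p)\<in>T. real t powr (-7/3))"
    proof (rule sum_le_included[where i = snd])
      show "finite T" by (auto simp: T_def)
      show "\<forall>p\<in>{p \<in> P. \<not> p \<le> r p ^ 2}. \<exists>a\<in>T. snd a = p \<and>
          real p powr (-2/3) / real (r p) \<le> (case a of (t, p) \<Rightarrow> real t powr (-7/3))"
      proof
        fix p assume p: "p \<in> {p \<in> P. \<not> p \<le> r p ^ 2}"
        then have pP: "p \<in> P" and gt: "r p ^ 2 < p" by auto
        have r1: "r p \<ge> 1" by (rule r(1)[OF pP])
        have "r p \<noteq> p"
        proof
          assume "r p = p"
          then show False using gt r1 by (simp add: power2_eq_square)
        qed
        then have "(r p, p) \<in> T" using r[OF pP] by (auto simp: T_def)
        moreover have "real p powr (-2/3) / real (r p) \<le> real (r p) powr (-7/3)"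
        proof -
          have "real (r p) powr 2 \<le> real p"
            using gt r1 by (simp add: powr_numeral flip: of_nat_power)
          then have "real p powr (-2/3) \<le> (real (r p) powr 2) powr (-2/3)"
            using r1 by (intro powr_mono2') auto
          also have "\<dots> = real (r p) powr (-4/3)"
            by (subst powr_powr) simp
          finally have "real p powr (-2/3) / real (r p) \<le> real (r p) powr (-4/3) / real (r p)"
            by (rule divide_right_mono) simp
          also have "\<dots> = real (r p) powr (-4/3) / real (r p) powr 1" by simp
          also have "\<dots> = real (r p) powr (-4/3 - 1)" by (rule powr_diff[symmetric])
          also have "-4/3 - 1 = (-7/3 :: real)" by simp
          finally show ?thesis .
        qed
        ultimately show "\<exists>a\<in>T. snd a = p \<and>
          real p powr (-2/3) / real (r p) \<le> (case a of (t, p) \<Rightarrow> real t powr (-7/3))"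
          by (intro bexI[of _ "(r p, p)"]) auto
      qed
    qed (use finP in auto)
    also have "\<dots> = (\<Sum>t=1..K. \<Sum>p\<in>prime_factors (fib t). real t powr (-7/3))"
      unfolding T_def by (subst sum.Sigma) auto
    also have "\<dots> \<le> (\<Sum>t=1..K. real t powr (-4/3))"
    proof (rule sum_mono)
      fix t assume t: "t \<in> {1..K}"
      have "(\<Sum>p\<in>prime_factors (fib t). real t powr (-7/3)) \<le> real t * real t powr (-7/3)"
        using card_prime_factors_fib_le[of t] by (simp add: mult_right_mono)
      also have "\<dots> = real t powr 1 * real t powr (-7/3)" using t by simp
      also have "\<dots> = real t powr (1 + (-7/3))" by (rule powr_add[symmetric])
      also have "1 + (-7/3) = (-4/3 :: real)" by simp
      finally show "(\<Sum>p\<in>prime_factors (fib t). real t powr (-7/3)) \<le> real t powr (-4/3)" .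
    qed
    also have "\<dots> \<le> C2" unfolding C2_def by (intro sum_le_suminf sum2) auto
    finally have part2: "(\<Sum>p\<in>{p \<in> P. \<not> p \<le> r p ^ 2}. real p powr (-2/3) / real (r p)) \<le> C2" .
    have "P = {p \<in> P. p \<le> r p ^ 2} \<union> {p \<in> P. \<not> p \<le> r p ^ 2}" by auto
    then have "(\<Sum>p\<in>P. real p powr (-2/3) / real (r p))
        = (\<Sum>p\<in>{p \<in> P. p \<le> r p ^ 2}. real p powr (-2/3) / real (r p))
          + (\<Sum>p\<in>{p \<in> P. \<not> p \<le> r p ^ 2}. real p powr (-2/3) / real (r p))"
      using finP by (subst sum.union_disjoint[symmetric]) auto
    then show ?thesis using part1 part2 by (simp add: P_def)
  qed
  then show ?thesis unfolding r_def using C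
    by (intro exI[of _ "C1 + C2 + 1"] conjI allI) (auto intro: order_trans add_increasing2)
qed

text \<open>
  For a prime \<open>p \<le> K\<close> and \<open>r = min p (fib_rank p)\<close>, the number of pairs of indices up to \<open>K\<close> whose floors
  agree modulo \<open>p\<close> is at most \<open>8 * K ^ 2 / r\<close>. Summed over \<open>p\<close> with the weights \<open>p powr (-2/3)\<close> this
  converges.
\<close>

lemma singular_series_average:
  "\<exists>C>0. \<forall>K\<ge>1. (\<Sum>(l, k) | 1 \<le> l \<and> l < k \<and> k \<le> K.
      \<Prod>p\<in>sieve_primes (gfloor k - gfloor l). 1 + 1 / real p) \<le> C * real K ^ 2"
proof -
  obtain C where C: "C > 0"
    "\<And>K. (\<Sum>p | prime p \<and> 7 \<le> p \<and> p \<le> K. real p powr (-2/3) / real (min p (fib_rank p))) \<le> C"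
    using sum_primes_fib_rank_bounded by blast
  have "(\<Sum>(l, k) | 1 \<le> l \<and> l < k \<and> k \<le> K.
      \<Prod>p\<in>sieve_primes (gfloor k - gfloor l). 1 + 1 / real p) \<le> 3 * (1 + 8 * C) * real K ^ 2"
    if K: "K \<ge> 1" for K
  proof -
    define W where "W = {(l, k). 1 \<le> l \<and> l < k \<and> k \<le> K}"
    define P where "P = {p. prime p \<and> 7 \<le> p \<and> p \<le> K}"
    have finP: "finite P" by (rule finite_subset[of _ "{..K}"]) (auto simp: P_def)
    have W_sub: "W \<subseteq> {1..K} \<times> {1..K}" by (auto simp: W_def)
    then have finW: "finite W" by (rule finite_subset) simp
    have h: "0 < gfloor k - gfloor l" "gfloor k - gfloor l < 2 ^ K"
        "int (gfloor k - gfloor l) = \<lfloor>\<phi> ^ k\<rfloor> - \<lfloor>\<phi> ^ l\<rfloor>" if "(l, k) \<in> W" for l k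
    proof -
      have lk: "1 \<le> l" "l < k" "k \<le> K" using that by (auto simp: W_def)
      have lt: "gfloor l < gfloor k" using lk by (intro gfloor_less)
      then show "0 < gfloor k - gfloor l" by simp
      show "int (gfloor k - gfloor l) = \<lfloor>\<phi> ^ k\<rfloor> - \<lfloor>\<phi> ^ l\<rfloor>"
        using lt by (simp add: of_nat_diff int_gfloor)
      have "gfloor k - gfloor l < gfloor k" using lt gfloor_pos[of l] by simp
      also have "\<dots> \<le> 2 ^ k" by (rule gfloor_le)
      also have "\<dots> \<le> 2 ^ K" using lk by (intro power_increasing) auto
      finally show "gfloor k - gfloor l < 2 ^ K" .
    qed
    have cardW: "real (card W) \<le> real K ^ 2"
    proof -
      have "card W \<le> card ({1..K} \<times> {1..K})" using W_sub by (intro card_mono) auto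
      also have "\<dots> = K ^ 2" by (simp add: power2_eq_square)
      finally show ?thesis by (metis of_nat_le_iff of_nat_power)
    qed
    have count: "real (card {(l, k) \<in> W. p dvd gfloor k - gfloor l}) \<le> 8 * real K ^ 2 / real (min p (fib_rank p))"
      if p: "p \<in> P" for p
    proof -
      have pp: "prime p" "p > 5" "p \<le> K" "p \<ge> 1" using p by (auto simp: P_def)
      define r where "r = min p (fib_rank p)"
      have r: "r \<ge> 1" "r \<le> K" "r \<le> fib_rank p" using pp fib_rank_cases(1)[of p] by (auto simp: r_def)
      have "{(l, k) \<in> W. p dvd gfloor k - gfloor l}
          \<subseteq> (SIGMA l:{1..K}. {k \<in> {1..K}. int p dvd \<lfloor>\<phi> ^ k\<rfloor> - \<lfloor>\<phi> ^ l\<rfloor>})"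
      proof (clarify)
        fix l k assume lk: "(l, k) \<in> W" "p dvd gfloor k - gfloor l"
        then have "int p dvd int (gfloor k - gfloor l)" by (simp only: int_dvd_int_iff)
        then have "int p dvd \<lfloor>\<phi> ^ k\<rfloor> - \<lfloor>\<phi> ^ l\<rfloor>" by (simp only: h(3)[OF lk(1)])
        then show "l \<in> {1..K} \<and> k \<in> {k \<in> {1..K}. int p dvd \<lfloor>\<phi> ^ k\<rfloor> - \<lfloor>\<phi> ^ l\<rfloor>}"
          using W_sub lk(1) by auto
      qed
      then have "card {(l, k) \<in> W. p dvd gfloor k - gfloor l}
          \<le> card (SIGMA l:{1..K}. {k \<in> {1..K}. int p dvd \<lfloor>\<phi> ^ k\<rfloor> - \<lfloor>\<phi> ^ l\<rfloor>})"
        by (intro card_mono) auto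
      also have "\<dots> = (\<Sum>l=1..K. card {k \<in> {1..K}. int p dvd \<lfloor>\<phi> ^ k\<rfloor> - \<lfloor>\<phi> ^ l\<rfloor>})"
        by (simp add: card_SigmaI)
      also have "\<dots> \<le> (\<Sum>l=1..K. 4 * (K div fib_rank p + 1))"
        using pp by (intro sum_mono card_coincidences_le)
      also have "\<dots> \<le> K * (4 * (K div r + 1))" using r by (simp add: div_le_mono2)
      finally have "real (card {(l, k) \<in> W. p dvd gfloor k - gfloor l}) \<le> real (K * (4 * (K div r + 1)))"
        by (simp only: of_nat_le_iff)
      also have "\<dots> = real K * (4 * (real (K div r) + 1))" by simp
      also have "\<dots> \<le> real K * (4 * (real K / real r + real K / real r))"
        using r of_nat_div_le_of_nat[of K r] by (intro mult_left_mono add_mono) (auto simp: le_divide_eq)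
      also have "\<dots> = 8 * real K ^ 2 / real r" by (simp add: power2_eq_square)
      finally show ?thesis by (simp add: r_def)
    qed
    have "(\<Sum>(l, k)\<in>W. \<Prod>p\<in>sieve_primes (gfloor k - gfloor l). 1 + 1 / real p)
        \<le> (\<Sum>(l, k)\<in>W. 3 * (1 + (\<Sum>p\<in>P. if p dvd gfloor k - gfloor l then real p powr (-2/3) else 0)))"
    proof (rule sum_mono, clarify)
      fix l k assume lk: "(l, k) \<in> W"
      have "{p \<in> sieve_primes (gfloor k - gfloor l). p \<le> K} = {p \<in> P. p dvd gfloor k - gfloor l}"
        by (auto simp: sieve_primes_def P_def)
      then have "(\<Sum>p\<in>{p \<in> sieve_primes (gfloor k - gfloor l). p \<le> K}. real p powr (-2/3))
          = (\<Sum>p\<in>P. if p dvd gfloor k - gfloor l then real p powr (-2/3) else 0)"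
        using finP by (simp only: sum.inter_filter)
      then show "(\<Prod>p\<in>sieve_primes (gfloor k - gfloor l). 1 + 1 / real p)
          \<le> 3 * (1 + (\<Sum>p\<in>P. if p dvd gfloor k - gfloor l then real p powr (-2/3) else 0))"
        using prod_sieve_primes_le[OF h(1,2)[OF lk] K] by simp
    qed
    also have "\<dots> = 3 * (real (card W)
        + (\<Sum>w\<in>W. \<Sum>p\<in>P. if p dvd gfloor (snd w) - gfloor (fst w) then real p powr (-2/3) else 0))"
      by (simp add: split_def sum.distrib flip: sum_distrib_left)
    finally have le: "(\<Sum>(l, k)\<in>W. \<Prod>p\<in>sieve_primes (gfloor k - gfloor l). 1 + 1 / real p)
        \<le> 3 * (real (card W)
          + (\<Sum>w\<in>W. \<Sum>p\<in>P. if p dvd gfloor (snd w) - gfloor (fst w) then real p powr (-2/3) else 0))" .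
    have "(\<Sum>w\<in>W. \<Sum>p\<in>P. if p dvd gfloor (snd w) - gfloor (fst w) then real p powr (-2/3) else 0)
        = (\<Sum>p\<in>P. real (card {(l, k) \<in> W. p dvd gfloor k - gfloor l}) * real p powr (-2/3))"
    proof (subst sum.swap, rule sum.cong[OF refl])
      fix p
      have "{(l, k) \<in> W. p dvd gfloor k - gfloor l} = {w \<in> W. p dvd gfloor (snd w) - gfloor (fst w)}" by auto
      then show "(\<Sum>w\<in>W. if p dvd gfloor (snd w) - gfloor (fst w) then real p powr (-2/3) else 0)
          = real (card {(l, k) \<in> W. p dvd gfloor k - gfloor l}) * real p powr (-2/3)"
        using finW by (simp flip: sum.inter_filter)
    qed
    also have "\<dots> \<le> (\<Sum>p\<in>P. 8 * real K ^ 2 / real (min p (fib_rank p)) * real p powr (-2/3))"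
      using count by (intro sum_mono mult_right_mono) auto
    also have "\<dots> = 8 * real K ^ 2 * (\<Sum>p\<in>P. real p powr (-2/3) / real (min p (fib_rank p)))"
      by (simp add: sum_distrib_left)
    also have "\<dots> \<le> 8 * real K ^ 2 * C"
      unfolding P_def by (intro mult_left_mono C(2)) simp
    finally have "(\<Sum>w\<in>W. \<Sum>p\<in>P. if p dvd gfloor (snd w) - gfloor (fst w) then real p powr (-2/3) else 0)
        \<le> 8 * real K ^ 2 * C" .
    then have "3 * (real (card W)
          + (\<Sum>w\<in>W. \<Sum>p\<in>P. if p dvd gfloor (snd w) - gfloor (fst w) then real p powr (-2/3) else 0))
        \<le> 3 * (real K ^ 2 + 8 * real K ^ 2 * C)"
      using cardW by (intro mult_left_mono add_mono) auto
    with le have "(\<Sum>(l, k)\<in>W. \<Prod>p\<in>sieve_primes (gfloor k - gfloor l). 1 + 1 / real p)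
        \<le> 3 * (real K ^ 2 + 8 * real K ^ 2 * C)"
      by (rule order_trans)
    then show ?thesis by (simp add: W_def algebra_simps)
  qed
  then show ?thesis using C(1) by (intro exI[of _ "3 * (1 + 8 * C)"]) auto
qed

section \<open>Romanoff's argument\<close>

text \<open>
  The Cauchy-Schwarz inequality for the fibres of a map.
\<close>

lemma card_square_le_card_image:
  fixes f :: "'a \<Rightarrow> 'b"
  assumes "finite A"
  shows "real (card A) ^ 2 \<le> real (card (f ` A)) * real (card {(x, y) \<in> A \<times> A. f x = f y})"
proof -
  define r where "r n = card {x \<in> A. f x = n}" for n
  have "card A = (\<Sum>n\<in>f ` A. r n)"
    unfolding r_def card_eq_sum using assms by (rule sum.image_gen)
  then have "real (card A) ^ 2 = (\<Sum>n\<in>f ` A. real (r n)) ^ 2" by simp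
  also have "\<dots> \<le> (\<Sum>n\<in>f ` A. real (r n) ^ 2) * real (card (f ` A))"
    by (rule sum_squared_le_sum_of_squares)
  also have "(\<Sum>n\<in>f ` A. real (r n) ^ 2) = real (card {(x, y) \<in> A \<times> A. f x = f y})"
  proof -
    have "{(x, y) \<in> A \<times> A. f x = f y} = (\<Union>n\<in>f ` A. {x \<in> A. f x = n} \<times> {x \<in> A. f x = n})"
      by auto
    also have "card \<dots> = (\<Sum>n\<in>f ` A. card ({x \<in> A. f x = n} \<times> {x \<in> A. f x = n}))"
      using assms by (intro card_UN_disjoint) auto
    also have "\<dots> = (\<Sum>n\<in>f ` A. r n ^ 2)" by (simp add: r_def card_cartesian_product power2_eq_square)
    finally show ?thesis by simp
  qed
  finally show ?thesis by (simp add: mult.commute)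
qed

text \<open>Two representations of one number with different exponents yield a prime pair.\<close>

lemma card_collisions_le:
  fixes N K :: nat
  defines "A \<equiv> {p. p < N \<and> prime p} \<times> {1..K}"
    and "W \<equiv> {(l, k). 1 \<le> l \<and> l < k \<and> k \<le> K}"
  shows "card {(x, y) \<in> A \<times> A. (\<lambda>(p, k). p + gfloor k) x = (\<lambda>(p, k). p + gfloor k) y}
    \<le> card {p. p < N \<and> prime p} * K
      + 2 * (\<Sum>(l, k)\<in>W. card {p. p < N \<and> prime p \<and> prime (p + (gfloor k - gfloor l))})"
proof -
  define pairs where "pairs h = {p. p < N \<and> prime p \<and> prime (p + h)}" for h
  define V where "V = (SIGMA w:W. pairs (gfloor (snd w) - gfloor (fst w)))"
  define g where "g = (\<lambda>((l, k), p). (((p + (gfloor k - gfloor l)), l), (p, k)))"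
  define B where "B = {(x, y) \<in> A \<times> A. (\<lambda>(p, k). p + gfloor k) x = (\<lambda>(p, k). p + gfloor k) y}"
  have finW: "finite W" by (rule finite_subset[of _ "{1..K} \<times> {1..K}"]) (auto simp: W_def)
  have finV: "finite V" unfolding V_def using finW by (auto simp: pairs_def)
  have finA: "finite A" by (simp add: A_def)
  have "B \<subseteq> (\<lambda>x. (x, x)) ` A \<union> (g ` V \<union> prod.swap ` g ` V)"
  proof
    fix b assume "b \<in> B"
    then obtain p k q l where b: "b = ((p, k), (q, l))" "(p, k) \<in> A" "(q, l) \<in> A"
      and eq: "p + gfloor k = q + gfloor l" by (auto simp: B_def)
    have memV: "b \<in> g ` V" if "b = ((p, k), (q, l))" "(p, k) \<in> A" "(q, l) \<in> A"
      "p + gfloor k = q + gfloor l" "k < l" for b p k q l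
    proof -
      have lt: "gfloor k < gfloor l" using that by (intro gfloor_less) (auto simp: A_def)
      then have p: "p = q + (gfloor l - gfloor k)" using that(4) by simp
      have "((k, l), q) \<in> V" using that p by (auto simp: V_def W_def A_def pairs_def)
      moreover have "g ((k, l), q) = b" using that(1) p by (simp add: g_def)
      ultimately show ?thesis by (metis imageI)
    qed
    consider "k = l" | "k < l" | "l < k" by linarith
    then show "b \<in> (\<lambda>x. (x, x)) ` A \<union> (g ` V \<union> prod.swap ` g ` V)"
    proof cases
      case 1
      then show ?thesis using b eq by auto
    next
      case 2
      then show ?thesis using memV[OF b(1,2,3) eq] by blast
    next
      case 3
      then have "((q, l), (p, k)) \<in> g ` V" using memV[OF refl b(3,2)] eq by simp
      then have "prod.swap ((q, l), (p, k)) \<in> prod.swap ` g ` V" by (rule imageI)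
      then show ?thesis by (simp add: b(1))
    qed
  qed
  then have "card B \<le> card ((\<lambda>x. (x, x)) ` A \<union> (g ` V \<union> prod.swap ` g ` V))"
    using finA finV by (intro card_mono) auto
  also have "\<dots> \<le> card ((\<lambda>x. (x, x)) ` A) + (card (g ` V) + card (prod.swap ` g ` V))"
    by (intro order_trans[OF card_Un_le] add_left_mono card_Un_le)
  also have "\<dots> \<le> card A + (card V + card V)"
    using finA finV
    by (intro add_mono card_image_le order_trans[OF card_image_le card_image_le]) auto
  also have "card A = card {p. p < N \<and> prime p} * K" by (simp add: A_def card_cartesian_product)
  also have "card V = (\<Sum>(l, k)\<in>W. card (pairs (gfloor k - gfloor l)))"
    unfolding V_def using finW by (subst card_SigmaI) (auto simp: pairs_def split_def)
  finally show ?thesis by (simp add: B_def pairs_def)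
qed

text \<open>
  There are at least a constant times \<open>N\<close> pairs of a prime below \<open>N\<close> and an exponent up to the binary logarithm
  of \<open>N\<close>, and at most a constant times \<open>N\<close> collisions between them; so the
  number of distinct sums is at least a constant times \<open>N\<close>.
\<close>

lemma card_S_phi_lower:
  "\<exists>c>0. \<forall>\<^sub>F N in sequentially. c * real N \<le> real (count_upto S_phi (2 * real N))"
proof -
  obtain C1 where C1: "C1 > 0"
    "\<forall>\<^sub>F N in sequentially. real (card {p. p < N \<and> prime p}) \<le> C1 * (real N / ln (real N))"
    using primes_upper by blast
  obtain C2 where C2: "C2 > 0" "\<forall>\<^sub>F N in sequentially. \<forall>h>0.
     real (card {p. p < N \<and> prime p \<and> prime (p + h)})
       \<le> C2 * (\<Prod>p\<in>sieve_primes h. 1 + 1 / real p) * (real N / ln (real N) ^ 2)"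
    using prime_pairs_upper by blast
  obtain C3 where C3: "C3 > 0" "\<And>K. K \<ge> 1 \<Longrightarrow> (\<Sum>(l, k) | 1 \<le> l \<and> l < k \<and> k \<le> K.
      \<Prod>p\<in>sieve_primes (gfloor k - gfloor l). 1 + 1 / real p) \<le> C3 * real K ^ 2"
    using singular_series_average by blast
  define C where "C = 2 * C1 + 8 * C2 * C3"
  have C: "C > 0" using C1(1) C2(1) C3(1) by (auto simp: C_def intro!: add_pos_pos)
  show ?thesis
  proof (rule exI[of _ "1 / (16 * C)"], intro conjI)
    show "\<forall>\<^sub>F N in sequentially. 1 / (16 * C) * real N \<le> real (count_upto S_phi (2 * real N))"
      using C1(2) C2(2) primes_lower eventually_ge_at_top[of 16]
    proof eventually_elim
      case (elim N)
      define K where "K = floor_log N"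
      define X where "X = real N"
      define L where "L = ln X"
      define \<pi> where "\<pi> = real (card {p. p < N \<and> prime p})"
      have X: "X \<ge> 16" using elim by (simp add: X_def)
      have L: "L > 0" using X by (simp add: L_def)
      have K2: "2 ^ K \<le> N" "N < 2 * 2 ^ K"
        unfolding K_def using elim by (auto intro: floor_log_exp2_le floor_log_exp2_gt)
      have "K \<ge> 4" unfolding K_def using floor_log_le_iff[of 16 N] elim
        by (simp add: floor_log.simps)
      then have K1: "K \<ge> 1" by simp
      have KU: "real K \<le> 2 * L"
      proof -
        have "real (2 ^ K) \<le> X" unfolding X_def using K2(1) by (simp only: of_nat_le_iff)
        then have "ln (2 ^ K) \<le> L" unfolding L_def by (intro ln_mono) auto
        then have "real K * ln 2 \<le> L" by (simp add: ln_realpow)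
        moreover have "real K * (1 / 2) \<le> real K * ln 2"
          using ln2_ge_two_thirds by (intro mult_left_mono) auto
        ultimately show ?thesis by simp
      qed
      have KL: "real K \<ge> L / 2"
      proof -
        have "X < real (2 * 2 ^ K)" unfolding X_def using K2(2) by (simp only: of_nat_less_iff)
        then have "L \<le> ln (2 * 2 ^ K)" unfolding L_def using X by (intro ln_mono) auto
        also have "\<dots> = ln 2 + real K * ln 2" by (simp add: ln_mult ln_realpow)
        also have "\<dots> \<le> 1 + real K * 1"
          using ln_le_minus_one[of 2] by (intro add_mono mult_left_mono) auto
        finally show ?thesis using K1 by simp
      qed
      define A where "A = {p. p < N \<and> prime p} \<times> {1..K}"
      define f where "f = (\<lambda>(p, k). p + gfloor k)"
      define D where "D = real (card {(x, y) \<in> A \<times> A. f x = f y})"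
      have finA: "finite A" by (simp add: A_def)
      have piU: "\<pi> \<le> C1 * (X / L)" and piL: "X / L / 2 \<le> \<pi>"
        using elim by (simp_all add: \<pi>_def X_def L_def)
      have "D \<le> real (card {p. p < N \<and> prime p} * K
          + 2 * (\<Sum>(l, k) | 1 \<le> l \<and> l < k \<and> k \<le> K. card {p. p < N \<and> prime p \<and> prime (p + (gfloor k - gfloor l))}))"
        unfolding D_def A_def f_def of_nat_le_iff by (rule card_collisions_le)
      also have "\<dots> = \<pi> * real K
          + 2 * (\<Sum>(l, k) | 1 \<le> l \<and> l < k \<and> k \<le> K. real (card {p. p < N \<and> prime p \<and> prime (p + (gfloor k - gfloor l))}))"
        by (simp add: \<pi>_def split_def)
      also have "\<dots> \<le> C1 * (X / L) * (2 * L)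
          + 2 * (\<Sum>(l, k) | 1 \<le> l \<and> l < k \<and> k \<le> K.
              C2 * (X / L ^ 2) * (\<Prod>p\<in>sieve_primes (gfloor k - gfloor l). 1 + 1 / real p))"
      proof (intro add_mono mult_mono mult_left_mono sum_mono)
        show "\<pi> \<le> C1 * (X / L)" by (rule piU)
        show "real K \<le> 2 * L" by (rule KU)
        fix w assume w: "w \<in> {(l, k). 1 \<le> l \<and> l < k \<and> k \<le> K}"
        obtain l k where lk: "w = (l, k)" by (cases w)
        have "gfloor k - gfloor l > 0" using gfloor_less[of l k] w lk by auto
        then have "real (card {p. p < N \<and> prime p \<and> prime (p + (gfloor k - gfloor l))})
          \<le> C2 * (\<Prod>p\<in>sieve_primes (gfloor k - gfloor l). 1 + 1 / real p) * (X / L ^ 2)"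
          using elim unfolding X_def L_def by blast
        then show "(case w of (l, k) \<Rightarrow> real (card {p. p < N \<and> prime p \<and> prime (p + (gfloor k - gfloor l))}))
          \<le> (case w of (l, k) \<Rightarrow> C2 * (X / L ^ 2) * (\<Prod>p\<in>sieve_primes (gfloor k - gfloor l). 1 + 1 / real p))"
          by (simp add: lk mult_ac)
      qed (use C1 X L in \<open>auto intro!: sum_nonneg\<close>)
      also have "(\<Sum>(l, k) | 1 \<le> l \<and> l < k \<and> k \<le> K.
              C2 * (X / L ^ 2) * (\<Prod>p\<in>sieve_primes (gfloor k - gfloor l). 1 + 1 / real p))
          = C2 * (X / L ^ 2) * (\<Sum>(l, k) | 1 \<le> l \<and> l < k \<and> k \<le> K.
              \<Prod>p\<in>sieve_primes (gfloor k - gfloor l). 1 + 1 / real p)"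
        by (simp only: sum_distrib_left split_def)
      also have "\<dots> \<le> C2 * (X / L ^ 2) * (C3 * (2 * L) ^ 2)"
      proof (intro mult_left_mono order_trans[OF C3(2)[OF K1]])
        show "real K ^ 2 \<le> (2 * L) ^ 2" using KU by (intro power_mono) auto
      qed (use C2 C3 X in auto)
      also have "C1 * (X / L) * (2 * L) + 2 * (C2 * (X / L ^ 2) * (C3 * (2 * L) ^ 2)) = C * X"
        using L by (simp add: C_def power2_eq_square field_simps)
      finally have D: "D \<le> C * X" by simp
      have cardA: "real (card A) \<ge> X / 4"
      proof -
        have "X / 4 = (X / L / 2) * (L / 2)" using L by simp
        also have "\<dots> \<le> \<pi> * real K"
          using piL KL X L by (intro mult_mono) (auto simp: \<pi>_def)
        finally show ?thesis by (simp add: A_def card_cartesian_product \<pi>_def)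
      qed
      have "(X / 4) ^ 2 \<le> real (card A) ^ 2" using cardA X by (intro power_mono) auto
      also have "\<dots> \<le> real (card (f ` A)) * D"
        unfolding D_def using finA by (rule card_square_le_card_image)
      also have "\<dots> \<le> real (card (f ` A)) * (C * X)" using D by (intro mult_left_mono) auto
      finally have "X * X \<le> (real (card (f ` A)) * 16 * C) * X"
        by (simp add: power2_eq_square mult_ac)
      then have "X \<le> real (card (f ` A)) * 16 * C" using X by simp
      then have "1 / (16 * C) * X \<le> real (card (f ` A))" using C by (simp add: field_simps)
      also have "card (f ` A) \<le> count_upto S_phi (2 * real N)"
      proof -
        have "int ` f ` A \<subseteq> {n \<in> S_phi. 1 \<le> n \<and> of_int n \<le> 2 * real N}"
        proof clarify
          fix p k assume pk: "(p, k) \<in> A"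
          then have p: "prime p" "p < N" "k \<in> {1..K}" by (auto simp: A_def)
          have "gfloor k \<le> 2 ^ k" by (rule gfloor_le)
          also have "(2 :: nat) ^ k \<le> 2 ^ K" using p by (intro power_increasing) auto
          finally have "f (p, k) \<le> 2 * N" using K2(1) p by (simp add: f_def)
          then have "real (f (p, k)) \<le> real (2 * N)" by (simp only: of_nat_le_iff)
          moreover have "int (f (p, k)) \<in> S_phi"
            unfolding S_phi_def f_def using p by (auto simp: int_gfloor intro!: exI[of _ "int p"] exI[of _ k])
          moreover have "f (p, k) \<ge> 1" using p by (simp add: f_def prime_gt_0_nat Suc_le_eq)
          ultimately show "int (f (p, k)) \<in> S_phi \<and> 1 \<le> int (f (p, k)) \<and> of_int (int (f (p, k))) \<le> 2 * real N"
            by simp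
        qed
        moreover have "finite {n \<in> S_phi. 1 \<le> n \<and> of_int n \<le> 2 * real N}"
          by (rule finite_subset[of _ "{1..int (2 * N)}"]) auto
        ultimately have "card (int ` f ` A) \<le> count_upto S_phi (2 * real N)"
          unfolding count_upto_def by (intro card_mono)
        then show ?thesis by (simp add: card_image)
      qed
      then have "real (card (f ` A)) \<le> real (count_upto S_phi (2 * real N))" by simp
      finally show ?case by (simp add: X_def)
    qed
  qed (use C in simp)
qed

lemma count_upto_mono:
  assumes "x \<le> y"
  shows "count_upto A x \<le> count_upto A y"
proof -
  have "finite {n \<in> A. 1 \<le> n \<and> real_of_int n \<le> y}"
    by (rule finite_subset[of _ "{1..\<lfloor>y\<rfloor>}"]) (auto simp: le_floor_iff)
  then show ?thesis unfolding count_upto_def using assms by (intro card_mono) auto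
qed

lemma Liminf_S_phi: "0 < Liminf at_top (\<lambda>x::real. ereal (real (count_upto S_phi x) / x))"
proof -
  obtain c where c: "c > 0"
    "\<forall>\<^sub>F N in sequentially. c * real N \<le> real (count_upto S_phi (2 * real N))"
    using card_S_phi_lower by blast
  have "filterlim (\<lambda>x::real. nat \<lfloor>x / 2\<rfloor>) sequentially at_top" by real_asymp
  then have "\<forall>\<^sub>F x::real in at_top. c * real (nat \<lfloor>x / 2\<rfloor>) \<le> real (count_upto S_phi (2 * real (nat \<lfloor>x / 2\<rfloor>)))"
    using c(2) by (rule eventually_compose_filterlim[rotated])
  then have "\<forall>\<^sub>F x in at_top. ereal (c / 4) \<le> ereal (real (count_upto S_phi x) / x)"
    using eventually_ge_at_top[of 4]
  proof eventually_elim
    case (elim x)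
    define N where "N = nat \<lfloor>x / 2\<rfloor>"
    have N: "real N \<le> x / 2" "real N \<ge> x / 4" unfolding N_def using elim by linarith+
    have "c * (x / 4) \<le> c * real N" using N c(1) by (intro mult_left_mono) auto
    also have "\<dots> \<le> real (count_upto S_phi (2 * real N))" using elim by (simp add: N_def)
    also have "\<dots> \<le> real (count_upto S_phi x)" using N by (simp add: count_upto_mono)
    finally show ?case using elim by (simp add: field_simps)
  qed
  then have "ereal (c / 4) \<le> Liminf at_top (\<lambda>x::real. ereal (real (count_upto S_phi x) / x))"
    by (rule Liminf_bounded)
  moreover have "0 < ereal (c / 4)" using c(1) by simp
  ultimately show ?thesis by (rule less_le_trans[rotated])
qed

theorem theorem1p2:
  shows "0 < Liminf at_top (\<lambda>x::real. ereal (real (count_upto S_phi x) / x))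
    \<and> Liminf at_top (\<lambda>x::real. ereal (real (count_upto S_phi x) / x))
        \<le> Limsup at_top (\<lambda>x::real. ereal (real (count_upto S_phi x) / x))
    \<and> Limsup at_top (\<lambda>x::real. ereal (real (count_upto S_phi x) / x)) \<le> ereal (1937 / 1938)
    \<and> (\<exists>E :: real \<Rightarrow> real. E \<in> O[at_top](\<lambda>x. ln x) \<and>
         (\<forall>x\<ge>1. real (card {n::int. 1 \<le> n \<and> of_int n \<le> x \<and>
                    n \<notin> {p. prime p} + {\<lfloor>\<phi> ^ k\<rfloor> | k::nat. k \<ge> 1}})
                \<ge> x / 1938 - E x))"
proof (intro conjI)
  show "Liminf at_top (\<lambda>x::real. ereal (real (count_upto S_phi x) / x))
      \<le> Limsup at_top (\<lambda>x::real. ereal (real (count_upto S_phi x) / x))"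
    by (rule Liminf_le_Limsup) simp
  show "\<exists>E :: real \<Rightarrow> real. E \<in> O[at_top](\<lambda>x. ln x) \<and>
         (\<forall>x\<ge>1. real (card {n::int. 1 \<le> n \<and> of_int n \<le> x \<and>
                    n \<notin> {p. prime p} + {\<lfloor>\<phi> ^ k\<rfloor> | k::nat. k \<ge> 1}})
                \<ge> x / 1938 - E x)"
  proof (intro exI conjI allI impI)
    show "(\<lambda>x. 5 + 7 * (ln (x + 1) / ln (3 / 2))) \<in> O[at_top](\<lambda>x::real. ln x)" by real_asymp
    show "x / 1938 - (5 + 7 * (ln (x + 1) / ln (3 / 2)))
        \<le> real (card {n::int. 1 \<le> n \<and> of_int n \<le> x \<and>
            n \<notin> {p. prime p} + {\<lfloor>\<phi> ^ k\<rfloor> | k::nat. k \<ge> 1}})" if "x \<ge> 1" for x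
      using card_not_in_S_phi[OF that] by (simp add: S_phi_eq_plus)
  qed
qed (rule Liminf_S_phi Limsup_S_phi)+

end
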